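(* Let $S=k_{\mathbf p}[x_1,\dots,x_n]$ be a noncommutative PI skew polynomial ring over a field $k$ of characteristic $0$ with $p_{ij}=\xi^{b_{ij}}$, $\xi$ a primitive $\ell$th root of unity with $\ell$ minimal, $B=(b_{ij})$ skew-symmetric over $\mathbb Z$, and let $O$ be the group generated by the conjugation automorphisms $\phi_1,\dots,\phi_n$ (full setting in the context). (1) Let $n=2$. Then $(S,O)$ does not satisfy Auslander's Theorem. (2) Let $n=3$. Then $(S,O)$ satisfies Auslander's Theorem if and only if $\gcd(b_{ij},\ell)=1$ for each $i\ne j$. (3) Let $n=4$. Then $(S,O)$ satisfies Auslander's Theorem if and only if both of the following hold: $\operatorname{pf}(B)\equiv 0 \pmod{\ell}$; and there does not exist an index $j$ and an integer $k$ such that $k\,b_{ij}\equiv 0\pmod{\ell}$ for all but one $i$ (i.e. for all $i\in\{1,2,3,4\}$ except exactly one).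
   Context: Setting: $k$ (the base field) has characteristic $0$. $\mathbf p=(p_{ij})\in M_n(k)$ is multiplicatively antisymmetric ($p_{ii}=1$, $p_{ji}=p_{ij}^{-1}$) with all $p_{ij}$ roots of unity. $S=k_{\mathbf p}[x_1,\dots,x_n]$ is the $k$-algebra generated by $x_1,\dots,x_n$ with relations $x_jx_i=p_{ij}x_ix_j$, graded by $\deg x_i=1$. $\xi$ is a primitive $\ell$th root of unity and $p_{ij}=\xi^{b_{ij}}$ with integers $b_{ij}$, $b_{ii}=0$, $b_{ji}=-b_{ij}$; $\ell$ is minimal and $\ell>1$ (equivalently $S$ is noncommutative), hence $\gcd(\{b_{ij}\}_{i,j},\ell)=1$. $\phi_i(f)=x_i^{-1}fx_i$, so $\phi_i(x_s)=p_{is}x_s$, and $O=\langle\phi_1,\dots,\phi_n\rangle$, a finite group of graded automorphisms of $S$. Auslander's Theorem holds for $(S,O)$ if the map $S\#O\to\operatorname{End}_{S^O}(S)$, $a\#g\mapsto(b\mapsto a\,g(b))$, from the skew group algebra, is an isomorphism. $\operatorname{pf}(B)$ is the Pfaffian; for $n=4$, $\operatorname{pf}(B)=b_{12}b_{34}-b_{13}b_{24}+b_{14}b_{23}$. *)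

theory Defs
  imports "HOL-Library.Poly_Mapping" "HOL-Number_Theory.Cong" "HOL-Algebra.QuotRing" "HOL-Algebra.Bij" "HOL-Algebra.Generated_Groups"
begin

section \<open>Skew polynomial rings by generators and relations\<close>

text \<open>Words in the letters \<open>x\<^sub>0, x\<^sub>1, \<dots>\<close> form the free monoid, written additively so that
  \<open>free_word \<Rightarrow>\<^sub>0 'k\<close> with the library multiplication is the free associative \<open>k\<close>-algebra.\<close>

datatype free_word = FW (letters: "nat list")

instantiation free_word :: monoid_add
begin

definition zero_free_word :: free_word
  where "0 = FW []"

definition plus_free_word :: "free_word \<Rightarrow> free_word \<Rightarrow> free_word"
  where "u + v = FW (letters u @ letters v)"

instance
  by standard (simp_all add: zero_free_word_def plus_free_word_def)

end

text \<open>\<open>k\<langle>x\<^sub>1, \<dots>, x\<^sub>n\<rangle>\<close>\<close>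

definition free_algebra :: "nat \<Rightarrow> (free_word \<Rightarrow>\<^sub>0 'k::field) ring"
  where "free_algebra n =
    \<lparr>carrier = {f. \<forall>w \<in> Poly_Mapping.keys f. set (letters w) \<subseteq> {1..n}},
     mult = (*), one = 1, zero = 0, add = (+)\<rparr>"

definition skew_relations :: "nat \<Rightarrow> (nat \<Rightarrow> nat \<Rightarrow> 'k::field) \<Rightarrow> (free_word \<Rightarrow>\<^sub>0 'k) set"
  where "skew_relations n p =
    {Poly_Mapping.single (FW [j, i]) 1 - Poly_Mapping.single (FW [i, j]) (p i j) | i j.
       i \<in> {1..n} \<and> j \<in> {1..n}}"

text \<open>\<open>k\<^sub>p[x\<^sub>1, \<dots>, x\<^sub>n]\<close>; \<^const>\<open>genideal\<close> is the generated two-sided ideal.\<close>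

definition skew_poly_ring :: "nat \<Rightarrow> (nat \<Rightarrow> nat \<Rightarrow> 'k::field) \<Rightarrow> (free_word \<Rightarrow>\<^sub>0 'k) set ring"
  where "skew_poly_ring n p =
    free_algebra n Quot (genideal (free_algebra n) (skew_relations n p))"

definition skew_var :: "nat \<Rightarrow> (nat \<Rightarrow> nat \<Rightarrow> 'k::field) \<Rightarrow> nat \<Rightarrow> (free_word \<Rightarrow>\<^sub>0 'k) set"
  where "skew_var n p i =
    genideal (free_algebra n) (skew_relations n p)
      +>\<^bsub>free_algebra n\<^esub> Poly_Mapping.single (FW [i]) 1"

text \<open>\<open>\<phi>\<^sub>i(f) = x\<^sub>i\<^sup>-\<^sup>1 f x\<^sub>i\<close>. Since \<open>x\<^sub>i\<close> is a normal element and a non-zero-divisor, this is the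
  unique \<open>g \<in> S\<close> with \<open>x\<^sub>i g = f x\<^sub>i\<close>, so no ring of fractions is needed.\<close>

definition conj_aut ::
    "nat \<Rightarrow> (nat \<Rightarrow> nat \<Rightarrow> 'k::field) \<Rightarrow> nat \<Rightarrow> (free_word \<Rightarrow>\<^sub>0 'k) set \<Rightarrow> (free_word \<Rightarrow>\<^sub>0 'k) set"
  where "conj_aut n p i =
    (let S = skew_poly_ring n p; x = skew_var n p i in
      (\<lambda>f \<in> carrier S. THE g. g \<in> carrier S \<and> x \<otimes>\<^bsub>S\<^esub> g = f \<otimes>\<^bsub>S\<^esub> x))"

definition conj_group ::
    "nat \<Rightarrow> (nat \<Rightarrow> nat \<Rightarrow> 'k::field) \<Rightarrow> ((free_word \<Rightarrow>\<^sub>0 'k) set \<Rightarrow> (free_word \<Rightarrow>\<^sub>0 'k) set) set"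
  where "conj_group n p =
    generate (BijGroup (carrier (skew_poly_ring n p))) (conj_aut n p ` {1..n})"


section \<open>Auslander's Theorem for a finite group of automorphisms\<close>

text \<open>Throughout, \<open>G\<close> is a finite group of automorphisms of \<open>R\<close>, represented (as in
  \<^const>\<open>BijGroup\<close>) by functions that are extensional on \<^term>\<open>carrier R\<close>.\<close>

definition fixed_ring :: "('a, 'm) ring_scheme \<Rightarrow> ('a \<Rightarrow> 'a) set \<Rightarrow> 'a set"
  where "fixed_ring R G = {r \<in> carrier R. \<forall>g \<in> G. g r = r}"

text \<open>The element \<open>\<Sum>\<^sub>g u\<^sub>g # g\<close> is the function \<open>u\<close> on \<open>G\<close>;
  the multiplication is the additive extension of \<open>(a # g)(b # h) = a g(b) # gh\<close>.\<close>

definition skew_group_ring :: "('a, 'm) ring_scheme \<Rightarrow> ('a \<Rightarrow> 'a) set \<Rightarrow> (('a \<Rightarrow> 'a) \<Rightarrow> 'a) ring"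
  where "skew_group_ring R G =
    \<lparr>carrier = G \<rightarrow>\<^sub>E carrier R,
     mult = (\<lambda>u v. \<lambda>k \<in> G.
       \<Oplus>\<^bsub>R\<^esub>q \<in> {(g, h). g \<in> G \<and> h \<in> G \<and> compose (carrier R) g h = k}.
         u (fst q) \<otimes>\<^bsub>R\<^esub> (fst q) (v (snd q))),
     one = (\<lambda>g \<in> G. if g = (\<lambda>r \<in> carrier R. r) then \<one>\<^bsub>R\<^esub> else \<zero>\<^bsub>R\<^esub>),
     zero = (\<lambda>g \<in> G. \<zero>\<^bsub>R\<^esub>),
     add = (\<lambda>u v. \<lambda>g \<in> G. u g \<oplus>\<^bsub>R\<^esub> v g)\<rparr>"

text \<open>Endomorphisms of \<open>R\<close> as a right module over a subring \<open>T\<close>.\<close>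

definition End_ring :: "('a, 'm) ring_scheme \<Rightarrow> 'a set \<Rightarrow> ('a \<Rightarrow> 'a) ring"
  where "End_ring R T =
    \<lparr>carrier = {f \<in> carrier R \<rightarrow>\<^sub>E carrier R.
       (\<forall>a \<in> carrier R. \<forall>b \<in> carrier R. f (a \<oplus>\<^bsub>R\<^esub> b) = f a \<oplus>\<^bsub>R\<^esub> f b) \<and>
       (\<forall>a \<in> carrier R. \<forall>t \<in> T. f (a \<otimes>\<^bsub>R\<^esub> t) = f a \<otimes>\<^bsub>R\<^esub> t)},
     mult = compose (carrier R),
     one = (\<lambda>a \<in> carrier R. a),
     zero = (\<lambda>a \<in> carrier R. \<zero>\<^bsub>R\<^esub>),
     add = (\<lambda>f g. \<lambda>a \<in> carrier R. f a \<oplus>\<^bsub>R\<^esub> g a)\<rparr>"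

definition auslander_map :: "('a, 'm) ring_scheme \<Rightarrow> ('a \<Rightarrow> 'a) set \<Rightarrow> (('a \<Rightarrow> 'a) \<Rightarrow> 'a) \<Rightarrow> 'a \<Rightarrow> 'a"
  where "auslander_map R G u =
    (\<lambda>b \<in> carrier R. \<Oplus>\<^bsub>R\<^esub>g \<in> G. u g \<otimes>\<^bsub>R\<^esub> g b)"

text \<open>For a \<open>k\<close>-algebra \<open>R\<close> and \<open>k\<close>-linear \<open>G\<close> the map is \<open>k\<close>-linear, so being a ring
  isomorphism and being a \<open>k\<close>-algebra isomorphism coincide.\<close>

definition satisfies_auslander :: "('a, 'm) ring_scheme \<Rightarrow> ('a \<Rightarrow> 'a) set \<Rightarrow> bool"
  where "satisfies_auslander R G \<longleftrightarrow>
    auslander_map R G \<in> ring_iso (skew_group_ring R G) (End_ring R (fixed_ring R G))"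


section \<open>The parameters\<close>

definition primitive_root_of_1 :: "nat \<Rightarrow> 'k::field \<Rightarrow> bool"
  where "primitive_root_of_1 m z \<longleftrightarrow> m > 0 \<and> z ^ m = 1 \<and> (\<forall>d. 0 < d \<and> d < m \<longrightarrow> z ^ d \<noteq> 1)"

text \<open>Indices range over \<open>{1..n}\<close>; values of \<open>p\<close> and \<open>B\<close> elsewhere are irrelevant.
  With \<open>l\<close> minimal, \<open>l > 1\<close> says that some \<open>p\<^sub>i\<^sub>j\<close> is not \<open>1\<close>, that is, that the ring is
  noncommutative.\<close>

locale skew_poly_setting =
  fixes n :: nat and p :: "nat \<Rightarrow> nat \<Rightarrow> 'k::field_char_0"
    and \<xi> :: 'k and l :: nat and B :: "nat \<Rightarrow> nat \<Rightarrow> int"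
  assumes p_diag: "i \<in> {1..n} \<Longrightarrow> p i i = 1"
    and p_antisym: "\<lbrakk>i \<in> {1..n}; j \<in> {1..n}\<rbrakk> \<Longrightarrow> p j i = inverse (p i j)"
    and p_root_of_1: "\<lbrakk>i \<in> {1..n}; j \<in> {1..n}\<rbrakk> \<Longrightarrow> \<exists>m>0. p i j ^ m = 1"
    and \<xi>_primitive: "primitive_root_of_1 l \<xi>"
    and p_eq: "\<lbrakk>i \<in> {1..n}; j \<in> {1..n}\<rbrakk> \<Longrightarrow> p i j = \<xi> powi B i j"
    and B_diag: "i \<in> {1..n} \<Longrightarrow> B i i = 0"
    and B_skew: "\<lbrakk>i \<in> {1..n}; j \<in> {1..n}\<rbrakk> \<Longrightarrow> B j i = - B i j"
    and l_minimal: "\<lbrakk>primitive_root_of_1 m z;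
        \<forall>i\<in>{1..n}. \<forall>j\<in>{1..n}. \<exists>c::int. p i j = z powi c\<rbrakk> \<Longrightarrow> l \<le> m"
    and l_gt_1: "l > 1"

definition pfaffian4 :: "(nat \<Rightarrow> nat \<Rightarrow> int) \<Rightarrow> int"
  where "pfaffian4 B = B 1 2 * B 3 4 - B 1 3 * B 2 4 + B 1 4 * B 2 3"

end

theory Submission
  imports Defs "HOL-Algebra.UnivPoly" "HOL-Library.Multiset"
begin

text \<open>The monomials \<open>x\<^sup>a\<close> form a basis of \<open>S\<close>, the group \<open>O\<close> acts on it by characters, and
  \<open>S\<^sup>O\<close> is spanned by the \<open>x\<^sup>t\<close> with \<open>B t \<equiv> 0\<close> modulo \<open>l\<close>. Call two exponents equivalent if they
  differ by such a vector \<open>t\<close>. The Auslander map is always an injective ring homomorphism, by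
  independence of characters. If every class contains, for each \<open>i\<close>, an exponent not involving
  \<open>x\<^sub>i\<close>, then an \<open>S\<^sup>O\<close>-linear endomorphism acts on the span of each class as a left multiplication,
  and orthogonality of characters writes it as an image of the skew group ring. Otherwise every
  exponent in the class of some \<open>x\<^sub>i\<close> involves \<open>x\<^sub>i\<close>, and left division by \<open>x\<^sub>i\<close> on the span of this class
  is an endomorphism of degree \<open>-1\<close>, outside the image. So Auslander's Theorem holds if and only if for
  each \<open>i\<close> the kernel of \<open>B\<close> modulo \<open>l\<close> contains a vector with \<open>i\<close>-th entry \<open>1\<close>. For \<open>n = 3\<close> the vector
  \<open>(b\<^sub>2\<^sub>3, -b\<^sub>1\<^sub>3, b\<^sub>1\<^sub>2)\<close> is in the kernel; for \<open>n = 4\<close> and \<open>pf B \<equiv> 0\<close> so are the columns of the Pfaffian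
  adjoint of \<open>B\<close>.\<close>

section \<open>The Auslander map is a ring homomorphism\<close>

lemma (in abelian_monoid) finsum_cartesian_product:
  assumes "finite A" "finite B" "\<And>a b. a \<in> A \<Longrightarrow> b \<in> B \<Longrightarrow> f (a, b) \<in> carrier G"
  shows "finsum G f (A \<times> B) = (\<Oplus>a\<in>A. \<Oplus>b\<in>B. f (a, b))"
proof -
  have "A \<times> B = (\<Union>a\<in>A. Pair a ` B)" by auto
  then have "finsum G f (A \<times> B) = (\<Oplus>a\<in>A. finsum G f (Pair a ` B))"
    using add.finprod_UN_disjoint[of A "\<lambda>a. Pair a ` B" f] assms by (force simp: disjnt_def pairwise_def)
  also have "\<dots> = (\<Oplus>a\<in>A. \<Oplus>b\<in>B. f (a, b))"
    using assms by (intro finsum_cong' refl finsum_reindex) (auto simp: inj_on_def intro!: finsum_closed)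
  finally show ?thesis .
qed

lemma (in abelian_monoid) finsum_group_by:
  assumes "finite A" "finite K" "\<And>x. x \<in> A \<Longrightarrow> f x \<in> carrier G" "\<And>x. x \<in> A \<Longrightarrow> \<kappa> x \<in> K"
  shows "(\<Oplus>k\<in>K. \<Oplus>x\<in>{x\<in>A. \<kappa> x = k}. f x) = finsum G f A"
proof -
  have "A = (\<Union>k\<in>K. {x\<in>A. \<kappa> x = k})" using assms(4) by auto
  moreover have "finsum G f (\<Union>k\<in>K. {x\<in>A. \<kappa> x = k}) = (\<Oplus>k\<in>K. \<Oplus>x\<in>{x\<in>A. \<kappa> x = k}. f x)"
    using assms(1-3) by (intro add.finprod_UN_disjoint) (auto simp: disjnt_def pairwise_def)
  ultimately show ?thesis by simp
qed

lemma (in abelian_monoid) finsum_delta: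
  assumes "finite A" "a \<in> A" "x \<in> carrier G"
  shows "(\<Oplus>i\<in>A. if i = a then x else \<zero>) = x"
  using add.finprod_singleton[OF assms(2,1), of "\<lambda>_. x"] assms(3) by (simp add: eq_commute)

text \<open>A finite set of permutations that is closed under composition is also closed under
  inverses, so these axioms describe a finite group of ring automorphisms.\<close>

locale ring_aut_group = ring R for R (structure) +
  fixes G :: "('a \<Rightarrow> 'a) set"
  assumes finite_G: "finite G"
    and aut: "g \<in> G \<Longrightarrow> g \<in> ring_hom R R"
    and Bij: "g \<in> G \<Longrightarrow> g \<in> Bij (carrier R)"
    and id_mem: "(\<lambda>r\<in>carrier R. r) \<in> G"
    and comp_mem: "\<lbrakk>g \<in> G; h \<in> G\<rbrakk> \<Longrightarrow> compose (carrier R) g h \<in> G"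
begin

lemma aut_closed [simp]: "\<lbrakk>g \<in> G; a \<in> carrier R\<rbrakk> \<Longrightarrow> g a \<in> carrier R"
  using aut ring_hom_closed by metis

lemma hom_ring: "g \<in> G \<Longrightarrow> ring_hom_ring R R g"
  using aut by (simp add: ring_hom_ringI2 ring_axioms)

lemma aut_finsum:
  "\<lbrakk>g \<in> G; f \<in> A \<rightarrow> carrier R\<rbrakk> \<Longrightarrow> g (\<Oplus>i\<in>A. f i) = (\<Oplus>i\<in>A. g (f i))"
  using ring_hom_ring.hom_finsum[OF hom_ring] by (simp add: comp_def)

text \<open>An invariant \<open>t\<close> satisfies
  \<open>g (a \<otimes> t) = g a \<otimes> t\<close> for every \<open>g\<close>, so it can be pulled
  out of the sum on the right.\<close>

lemma auslander_map_in_End: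
  assumes u: "u \<in> G \<rightarrow>\<^sub>E carrier R"
  shows "auslander_map R G u \<in> carrier (End_ring R (fixed_ring R G))"
proof -
  have u': "u g \<in> carrier R" if "g \<in> G" for g using u that by auto
  have add: "auslander_map R G u (a \<oplus> b) = auslander_map R G u a \<oplus> auslander_map R G u b"
    if ab: "a \<in> carrier R" "b \<in> carrier R" for a b
  proof -
    have "(\<Oplus>g\<in>G. u g \<otimes> g (a \<oplus> b)) = (\<Oplus>g\<in>G. u g \<otimes> g a \<oplus> u g \<otimes> g b)"
      using ab u' by (intro finsum_cong' refl) (auto simp: r_distr ring_hom_add[OF aut])
    then show ?thesis
      using ab u' by (simp add: auslander_map_def finsum_addf Pi_def)
  qed
  have lin: "auslander_map R G u (a \<otimes> t) = auslander_map R G u a \<otimes> t"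
    if a: "a \<in> carrier R" and t: "t \<in> fixed_ring R G" for a t
  proof -
    have tc: "t \<in> carrier R" and tg: "\<And>g. g \<in> G \<Longrightarrow> g t = t"
      using t by (auto simp: fixed_ring_def)
    have "(\<Oplus>g\<in>G. u g \<otimes> g (a \<otimes> t)) = (\<Oplus>g\<in>G. (u g \<otimes> g a) \<otimes> t)"
    proof (intro finsum_cong' refl)
      fix g assume g: "g \<in> G"
      then show "u g \<otimes> g (a \<otimes> t) = (u g \<otimes> g a) \<otimes> t"
        using a tc u' tg[OF g] by (simp add: m_assoc ring_hom_mult[OF aut])
    qed (use a tc u' in auto)
    then show ?thesis
      using a tc u' finsum_ldistr[OF finite_G tc, of "\<lambda>g. u g \<otimes> g a"]
      by (simp add: auslander_map_def Pi_def)
  qed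
  have "auslander_map R G u \<in> carrier R \<rightarrow>\<^sub>E carrier R"
    using u' by (auto simp: auslander_map_def intro!: finsum_closed)
  then show ?thesis using add lin by (simp add: End_ring_def)
qed

text \<open>The coefficient of the product at \<open>k\<close> is a sum over the factorisations of
  \<open>k\<close>. Summed over all \<open>k\<close> this becomes a sum over all pairs
  \<open>(g, h)\<close>, and since \<open>g\<close> is a ring homomorphism the sum over
  \<open>h\<close> can be collected inside \<open>g\<close>.\<close>

lemma auslander_map_mult:
  assumes u: "u \<in> G \<rightarrow>\<^sub>E carrier R" and v: "v \<in> G \<rightarrow>\<^sub>E carrier R" and b: "b \<in> carrier R"
  shows "auslander_map R G (u \<otimes>\<^bsub>skew_group_ring R G\<^esub> v) b
    = auslander_map R G u (auslander_map R G v b)"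
proof -
  let ?c = "\<lambda>q. compose (carrier R) (fst q) (snd q)"
  let ?t = "\<lambda>q. (u (fst q) \<otimes> fst q (v (snd q))) \<otimes> ?c q b"
  let ?F = "\<lambda>k. {q \<in> G \<times> G. ?c q = k}"
  have [simp]: "u g \<in> carrier R" "v g \<in> carrier R" if "g \<in> G" for g using u v that by auto
  have fin: "finite (G \<times> G)" using finite_G by simp
  have eqF: "{(g, h). g \<in> G \<and> h \<in> G \<and> compose (carrier R) g h = k} = ?F k" for k by auto
  have "auslander_map R G (u \<otimes>\<^bsub>skew_group_ring R G\<^esub> v) b
      = (\<Oplus>k\<in>G. (\<Oplus>q\<in>?F k. u (fst q) \<otimes> fst q (v (snd q))) \<otimes> k b)"
    using b by (auto simp: auslander_map_def skew_group_ring_def eqF cong: restrict_cong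
        intro!: finsum_cong' finsum_closed)
  also have "\<dots> = (\<Oplus>k\<in>G. \<Oplus>q\<in>?F k. ?t q)"
  proof (rule finsum_cong')
    fix k assume k: "k \<in> G"
    have "(\<Oplus>q\<in>?F k. u (fst q) \<otimes> fst q (v (snd q))) \<otimes> k b
        = (\<Oplus>q\<in>?F k. (u (fst q) \<otimes> fst q (v (snd q))) \<otimes> k b)"
      using k b fin by (intro finsum_ldistr) auto
    also have "\<dots> = (\<Oplus>q\<in>?F k. ?t q)"
      using k b by (intro finsum_cong') (auto simp: comp_mem)
    finally show "(\<Oplus>q\<in>?F k. u (fst q) \<otimes> fst q (v (snd q))) \<otimes> k b = (\<Oplus>q\<in>?F k. ?t q)" .
  qed (use b in \<open>auto intro!: finsum_closed simp: comp_mem\<close>)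
  also have "\<dots> = finsum R ?t (G \<times> G)"
    using fin finite_G b by (intro finsum_group_by) (auto simp: comp_mem)
  also have "\<dots> = (\<Oplus>g\<in>G. \<Oplus>h\<in>G. ?t (g, h))"
    using finite_G b by (intro finsum_cartesian_product) (auto simp: comp_mem)
  also have "\<dots> = (\<Oplus>g\<in>G. u g \<otimes> g (\<Oplus>h\<in>G. v h \<otimes> h b))"
  proof (rule finsum_cong')
    fix g assume g: "g \<in> G"
    have "u g \<otimes> g (\<Oplus>h\<in>G. v h \<otimes> h b) = u g \<otimes> (\<Oplus>h\<in>G. g (v h \<otimes> h b))"
      using g b by (subst aut_finsum) auto
    also have "\<dots> = (\<Oplus>h\<in>G. u g \<otimes> g (v h \<otimes> h b))"
      using g b finite_G by (intro finsum_rdistr) auto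
    also have "\<dots> = (\<Oplus>h\<in>G. ?t (g, h))"
      using g b by (intro finsum_cong')
        (auto simp: compose_def m_assoc ring_hom_mult[OF aut] comp_mem)
    finally show "(\<Oplus>h\<in>G. ?t (g, h)) = u g \<otimes> g (\<Oplus>h\<in>G. v h \<otimes> h b)" by simp
  qed (use b in \<open>auto intro!: finsum_closed\<close>)
  also have "\<dots> = auslander_map R G u (auslander_map R G v b)"
    using b by (simp add: auslander_map_def finsum_closed)
  finally show ?thesis .
qed

lemma auslander_map_ring_hom:
  "auslander_map R G \<in> ring_hom (skew_group_ring R G) (End_ring R (fixed_ring R G))"
proof (rule ring_hom_memI)
  fix u v assume "u \<in> carrier (skew_group_ring R G)" "v \<in> carrier (skew_group_ring R G)"
  then have u: "u \<in> G \<rightarrow>\<^sub>E carrier R" and v: "v \<in> G \<rightarrow>\<^sub>E carrier R"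
    by (auto simp: skew_group_ring_def)
  have [simp]: "u g \<in> carrier R" "v g \<in> carrier R" if "g \<in> G" for g using u v that by auto
  show "auslander_map R G u \<in> carrier (End_ring R (fixed_ring R G))"
    using auslander_map_in_End[OF u] .
  have v': "auslander_map R G v b \<in> carrier R" if "b \<in> carrier R" for b
    using auslander_map_in_End[OF v] that by (auto simp: End_ring_def)
  have "auslander_map R G (u \<otimes>\<^bsub>skew_group_ring R G\<^esub> v)
      = compose (carrier R) (auslander_map R G u) (auslander_map R G v)"
  proof
    fix b show "auslander_map R G (u \<otimes>\<^bsub>skew_group_ring R G\<^esub> v) b
      = compose (carrier R) (auslander_map R G u) (auslander_map R G v) b"
      by (cases "b \<in> carrier R") (simp add: auslander_map_mult[OF u v] compose_def,
          simp add: auslander_map_def compose_def)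
  qed
  then show "auslander_map R G (u \<otimes>\<^bsub>skew_group_ring R G\<^esub> v)
      = auslander_map R G u \<otimes>\<^bsub>End_ring R (fixed_ring R G)\<^esub> auslander_map R G v"
    by (simp add: End_ring_def)
  have "auslander_map R G (u \<oplus>\<^bsub>skew_group_ring R G\<^esub> v) b
      = auslander_map R G u b \<oplus> auslander_map R G v b" if b: "b \<in> carrier R" for b
  proof -
    have "(\<Oplus>g\<in>G. (u \<oplus>\<^bsub>skew_group_ring R G\<^esub> v) g \<otimes> g b) = (\<Oplus>g\<in>G. u g \<otimes> g b \<oplus> v g \<otimes> g b)"
      using b by (intro finsum_cong') (auto simp: skew_group_ring_def l_distr)
    then show ?thesis using b by (simp add: auslander_map_def finsum_addf Pi_def)
  qed
  then show "auslander_map R G (u \<oplus>\<^bsub>skew_group_ring R G\<^esub> v)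
      = auslander_map R G u \<oplus>\<^bsub>End_ring R (fixed_ring R G)\<^esub> auslander_map R G v"
    by (auto simp: End_ring_def auslander_map_def)
next
  have "(\<Oplus>g\<in>G. \<one>\<^bsub>skew_group_ring R G\<^esub> g \<otimes> g b) = b" if b: "b \<in> carrier R" for b
  proof -
    have "(\<Oplus>g\<in>G. \<one>\<^bsub>skew_group_ring R G\<^esub> g \<otimes> g b)
        = (\<Oplus>g\<in>G. if g = (\<lambda>r\<in>carrier R. r) then b else \<zero>)"
      using b by (intro finsum_cong') (auto simp: skew_group_ring_def)
    then show ?thesis using b finsum_delta[OF finite_G id_mem] by simp
  qed
  then show "auslander_map R G \<one>\<^bsub>skew_group_ring R G\<^esub> = \<one>\<^bsub>End_ring R (fixed_ring R G)\<^esub>"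
    by (auto simp: auslander_map_def End_ring_def)
qed

lemma satisfies_auslander_iff_bij:
  "satisfies_auslander R G \<longleftrightarrow>
    bij_betw (auslander_map R G) (G \<rightarrow>\<^sub>E carrier R) (carrier (End_ring R (fixed_ring R G)))"
  using auslander_map_ring_hom
  by (simp add: satisfies_auslander_def ring_iso_def) (simp add: skew_group_ring_def)

end

section \<open>The monomial basis\<close>

definition lin_ext :: "('a \<Rightarrow> 'b::zero \<Rightarrow> 'c::comm_monoid_add) \<Rightarrow> ('a \<Rightarrow>\<^sub>0 'b) \<Rightarrow> 'c"
  where "lin_ext f F = (\<Sum>a\<in>Poly_Mapping.keys F. f a (Poly_Mapping.lookup F a))"

lemma lin_ext_0 [simp]: "lin_ext f 0 = 0"
  by (simp add: lin_ext_def)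

lemma lin_ext_zero_fun [simp]: "lin_ext (\<lambda>a c. 0) F = 0"
  by (simp add: lin_ext_def)

lemma lin_ext_single: "f a 0 = 0 \<Longrightarrow> lin_ext f (Poly_Mapping.single a c) = f a c"
  by (simp add: lin_ext_def)

lemma lin_ext_add:
  assumes "\<And>a. f a 0 = 0" "\<And>a c d. f a (c + d) = f a c + f a d"
  shows "lin_ext f (F + G) = lin_ext f F + lin_ext f G"
  unfolding lin_ext_def by (intro setsum_keys_plus_distrib assms)

lemma lin_ext_add_fun:
  "lin_ext (\<lambda>a c. f a c + g a c) F = lin_ext f F + lin_ext g F"
  by (simp add: lin_ext_def sum.distrib)

lemma single_sum: "Poly_Mapping.single a (\<Sum>i\<in>A. f i) = (\<Sum>i\<in>A. Poly_Mapping.single a (f i))"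
  by (induction A rule: infinite_finite_induct) (simp_all add: single_add)

lemma poly_mapping_sum_single:
  fixes F :: "'a \<Rightarrow>\<^sub>0 'b::comm_monoid_add"
  shows "F = (\<Sum>a\<in>Poly_Mapping.keys F. Poly_Mapping.single a (Poly_Mapping.lookup F a))"
  by (rule poly_mapping_eqI) (simp add: lookup_sum lookup_single when_def in_keys_iff)

text \<open>The \<open>single\<close> case is restricted to keys of \<open>F\<close>, so that a
  hypothesis on the support of \<open>F\<close> can be used for each of its terms.\<close>

lemma poly_mapping_additive_induct [case_names zero single add]:
  fixes F :: "'a \<Rightarrow>\<^sub>0 'b::comm_monoid_add"
  assumes "P 0"
    and single: "\<And>a c. a \<in> Poly_Mapping.keys F \<Longrightarrow> P (Poly_Mapping.single a c)"
    and add: "\<And>G H. P G \<Longrightarrow> P H \<Longrightarrow> P (G + H)"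
  shows "P F"
proof -
  have "P (\<Sum>a\<in>A. Poly_Mapping.single a (Poly_Mapping.lookup F a))"
    if "finite A" "A \<subseteq> Poly_Mapping.keys F" for A
    using that by (induction A) (auto intro: assms)
  then show ?thesis using poly_mapping_sum_single[of F] by (metis finite_keys order_refl)
qed

section \<open>The free algebra as a ring\<close>

lemma free_algebra_simps [simp]:
  "f \<otimes>\<^bsub>free_algebra n\<^esub> g = f * g" "f \<oplus>\<^bsub>free_algebra n\<^esub> g = f + g"
  "\<one>\<^bsub>free_algebra n\<^esub> = 1" "\<zero>\<^bsub>free_algebra n\<^esub> = 0"
  by (simp_all add: free_algebra_def)

lemma ring_free_algebra: "ring (free_algebra n :: (free_word \<Rightarrow>\<^sub>0 'k::field) ring)"
proof -
  let ?F = "free_algebra n :: (free_word \<Rightarrow>\<^sub>0 'k) ring"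
  have add: "f + g \<in> carrier ?F" if "f \<in> carrier ?F" "g \<in> carrier ?F" for f g
    using that keys_add[of f g] by (auto simp: free_algebra_def)
  have mult: "f * g \<in> carrier ?F" if "f \<in> carrier ?F" "g \<in> carrier ?F" for f g
    using that keys_mult[of f g] by (fastforce simp: free_algebra_def plus_free_word_def)
  have neg: "- f \<in> carrier ?F" if "f \<in> carrier ?F" for f
    using that by (auto simp: free_algebra_def in_keys_iff)
  have zero: "0 \<in> carrier ?F" and one: "1 \<in> carrier ?F"
    by (simp_all add: free_algebra_def zero_free_word_def)
  show ?thesis
  proof (rule ringI)
    show "abelian_group ?F"
    proof (rule abelian_groupI)
      show "\<exists>g\<in>carrier ?F. g \<oplus>\<^bsub>?F\<^esub> f = \<zero>\<^bsub>?F\<^esub>" if "f \<in> carrier ?F" for f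
        using neg[OF that] by (intro bexI[of _ "- f"]) simp_all
    qed (simp_all add: add zero ac_simps)
    show "monoid ?F"
      by (rule monoidI) (simp_all add: mult one mult.assoc)
  qed (simp_all add: distrib_left distrib_right)
qed

lemma single_in_free_algebra:
  "set w \<subseteq> {1..n} \<Longrightarrow> Poly_Mapping.single (FW w) c \<in> carrier (free_algebra n)"
  by (auto simp: free_algebra_def)

context skew_poly_setting
begin

section \<open>Sorting words, and the twisted product of monomials\<close>

lemma xi_nonzero [simp]: "\<xi> \<noteq> 0"
  using \<xi>_primitive by (auto simp: primitive_root_of_1_def power_0_left split: if_splits)

text \<open>Exponent vectors are multisets of indices; the ordered monomials multiply by
  \<open>x\<^sup>a x\<^sup>b = \<xi> powi beta a b \<cdot> x\<^sup>a\<^sup>+\<^sup>b\<close>.\<close>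

definition beta :: "nat multiset \<Rightarrow> nat multiset \<Rightarrow> int"
  where "beta a b = (\<Sum>j\<in>#a. \<Sum>i\<in>#b. if i < j then B i j else 0)"

lemma beta_simps [simp]:
  "beta (a + a') b = beta a b + beta a' b" "beta a (b + b') = beta a b + beta a b'"
  "beta {#} b = 0" "beta a {#} = 0"
  by (simp_all add: beta_def sum_mset.distrib)

lemma beta_add_mset:
  "beta (add_mset j a) b = beta {#j#} b + beta a b" "beta a (add_mset i b) = beta a {#i#} + beta a b"
  using beta_simps(1)[of "{#j#}" a b] beta_simps(2)[of a "{#i#}" b] by simp_all

lemma beta_single: "beta {#j#} {#i#} = (if i < j then B i j else 0)"
  by (simp add: beta_def)

text \<open>The exponent of \<open>\<xi>\<close> picked up when a word is sorted: by
  \<open>x_j x_i = p_ij x_i x_j\<close>, a letter \<open>j\<close> that passes a smaller letter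
  \<open>i\<close> on its right contributes \<open>B i j\<close>.\<close>

fun inversions :: "nat list \<Rightarrow> int"
  where "inversions [] = 0" | "inversions (j # w) = beta {#j#} (mset w) + inversions w"

text \<open>Inverted pairs lie within \<open>u\<close>, within \<open>v\<close>, or across the two.
  The last kind depends only on the letters and not on their order, hence on multisets.\<close>

lemma inversions_append: "inversions (u @ v) = inversions u + inversions v + beta (mset u) (mset v)"
proof (induction u)
  case (Cons j u)
  then show ?case by (simp add: beta_add_mset(1)[of j "mset u"])
qed simp

lemma beta_least: "\<forall>i\<in>#a. j \<le> i \<Longrightarrow> beta {#j#} a = 0"
  by (induction a) (simp_all add: beta_def)

lemma inversions_sorted: "sorted w \<Longrightarrow> inversions w = 0"
  by (induction w) (auto simp: beta_least)

definition normal_form :: "(free_word \<Rightarrow>\<^sub>0 'k) \<Rightarrow> (nat multiset \<Rightarrow>\<^sub>0 'k)"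
  where "normal_form = lin_ext (\<lambda>w c.
    Poly_Mapping.single (mset (letters w)) (c * \<xi> powi inversions (letters w)))"

text \<open>The product of the monoid algebra of exponents, twisted by the cocycle
  \<open>\<xi> powi beta a b\<close>.\<close>

definition star :: "(nat multiset \<Rightarrow>\<^sub>0 'k) \<Rightarrow> (nat multiset \<Rightarrow>\<^sub>0 'k) \<Rightarrow> (nat multiset \<Rightarrow>\<^sub>0 'k)" (infixl "\<star>" 70)
  where "F \<star> G = lin_ext (\<lambda>a c. lin_ext (\<lambda>b d. Poly_Mapping.single (a + b) (c * d * \<xi> powi beta a b)) G) F"

lemma normal_form_0 [simp]: "normal_form 0 = 0"
  by (simp add: normal_form_def)

lemma normal_form_add: "normal_form (f + g) = normal_form f + normal_form g"
  unfolding normal_form_def by (intro lin_ext_add) (simp_all add: single_add[symmetric] algebra_simps)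

lemma normal_form_single:
  "normal_form (Poly_Mapping.single (FW w) c) = Poly_Mapping.single (mset w) (c * \<xi> powi inversions w)"
  by (simp add: normal_form_def lin_ext_single)

lemma star_0 [simp]: "0 \<star> G = 0" "F \<star> 0 = 0"
  by (simp_all add: star_def lin_ext_def)

lemma star_add_right: "F \<star> (G + H) = F \<star> G + F \<star> H"
  unfolding star_def
  by (subst lin_ext_add) (simp_all add: single_add[symmetric] algebra_simps lin_ext_add_fun)

lemma star_add_left: "(F + G) \<star> H = F \<star> H + G \<star> H"
  unfolding star_def
  by (subst lin_ext_add) (simp_all add: lin_ext_add_fun single_add distrib_right)

lemma star_single [simp]:
  "Poly_Mapping.single a c \<star> Poly_Mapping.single b d = Poly_Mapping.single (a + b) (c * d * \<xi> powi beta a b)"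
  by (simp add: star_def lin_ext_single)

text \<open>On monomials both sides carry the exponent
  \<open>beta a b + beta a c + beta b c\<close>, because \<open>beta\<close> is additive in each
  argument.\<close>

lemma star_assoc: "(F \<star> G) \<star> H = F \<star> (G \<star> H)"
proof (induction F rule: poly_mapping_additive_induct)
  case (single a c)
  show ?case
  proof (induction G rule: poly_mapping_additive_induct)
    case (single b d)
    show ?case
      by (induction H rule: poly_mapping_additive_induct)
        (simp_all add: star_add_right add.assoc power_int_add algebra_simps)
  qed (simp_all add: star_add_left star_add_right)
qed (simp_all add: star_add_left)

lemma star_one [simp]: "1 \<star> F = F" "F \<star> 1 = F"
  using star_single[of 0 1] star_single[of _ _ 0 1]
  by (induction F rule: poly_mapping_additive_induct; simp add: star_add_left star_add_right)+

text \<open>On words this is \<open>inversions_append\<close>.\<close>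

lemma normal_form_mult: "normal_form (f * g) = normal_form f \<star> normal_form g"
proof (induction f rule: poly_mapping_additive_induct)
  case (single u c)
  show ?case
  proof (induction g rule: poly_mapping_additive_induct)
    case (single v d)
    show ?case
      by (cases u; cases v) (simp add: mult_single plus_free_word_def normal_form_single
          inversions_append power_int_add algebra_simps)
  qed (simp_all add: star_add_right normal_form_add algebra_simps)
qed (simp_all add: star_add_left normal_form_add algebra_simps)

section \<open>An explicit model of the skew polynomial ring\<close>

definition monomials :: "nat multiset set"
  where "monomials = {a. set_mset a \<subseteq> {1..n}}"

lemma monomials_simps [simp]:
  "{#} \<in> monomials" "a + b \<in> monomials \<longleftrightarrow> a \<in> monomials \<and> b \<in> monomials"
  "add_mset i a \<in> monomials \<longleftrightarrow> i \<in> {1..n} \<and> a \<in> monomials"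
  by (auto simp: monomials_def)

definition model :: "(nat multiset \<Rightarrow>\<^sub>0 'k) ring"
  where "model = \<lparr>carrier = {F. Poly_Mapping.keys F \<subseteq> monomials}, mult = (\<star>),
    one = 1, zero = 0, add = (+)\<rparr>"

lemma keys_star:
  "Poly_Mapping.keys (F \<star> G) \<subseteq> {a + b | a b. a \<in> Poly_Mapping.keys F \<and> b \<in> Poly_Mapping.keys G}"
  unfolding star_def lin_ext_def
  by (rule order_trans[OF keys_sum] UN_least)+ (auto split: if_splits)

lemma model_simps [simp]:
  "F \<otimes>\<^bsub>model\<^esub> G = F \<star> G" "F \<oplus>\<^bsub>model\<^esub> G = F + G" "\<one>\<^bsub>model\<^esub> = 1" "\<zero>\<^bsub>model\<^esub> = 0"
  by (simp_all add: model_def)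

lemma carrier_model: "F \<in> carrier model \<longleftrightarrow> Poly_Mapping.keys F \<subseteq> monomials"
  by (simp add: model_def)

lemma ring_model: "ring model"
proof -
  have add: "F + G \<in> carrier model" if "F \<in> carrier model" "G \<in> carrier model" for F G
    using that keys_add[of F G] by (auto simp: carrier_model)
  have mult: "F \<star> G \<in> carrier model" if "F \<in> carrier model" "G \<in> carrier model" for F G
    using that keys_star[of F G] by (fastforce simp: carrier_model)
  have neg: "- F \<in> carrier model" if "F \<in> carrier model" for F
    using that by (simp add: carrier_model)
  have zero: "0 \<in> carrier model" and one: "1 \<in> carrier model"
    by (simp_all add: carrier_model)
  show ?thesis
  proof (rule ringI)
    show "abelian_group model"
    proof (rule abelian_groupI)
      show "\<exists>G\<in>carrier model. G \<oplus>\<^bsub>model\<^esub> F = \<zero>\<^bsub>model\<^esub>" if "F \<in> carrier model" for F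
        using neg[OF that] by (intro bexI[of _ "- F"]) simp_all
    qed (simp_all add: add zero ac_simps)
    show "monoid model"
      by (rule monoidI) (simp_all add: mult one star_assoc)
  qed (simp_all add: star_add_left star_add_right)
qed

lemma keys_normal_form:
  "Poly_Mapping.keys (normal_form f) \<subseteq> (\<lambda>w. mset (letters w)) ` Poly_Mapping.keys f"
  unfolding normal_form_def lin_ext_def
  by (rule order_trans[OF keys_sum] UN_least)+ (auto split: if_splits)

lemma normal_form_hom: "ring_hom_ring (free_algebra n) model normal_form"
proof (rule ring_hom_ringI[OF ring_free_algebra ring_model])
  fix f :: "free_word \<Rightarrow>\<^sub>0 'k" assume "f \<in> carrier (free_algebra n)"
  then show "normal_form f \<in> carrier model"
    using keys_normal_form[of f] by (force simp: free_algebra_def model_def monomials_def)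
next
  show "normal_form \<one>\<^bsub>free_algebra n\<^esub> = \<one>\<^bsub>model\<^esub>"
    using normal_form_single[of "[]" 1]
    by (simp add: free_algebra_def model_def flip: zero_free_word_def)
qed (simp_all add: free_algebra_def model_def normal_form_mult normal_form_add)

text \<open>An additive section of \<open>normal_form\<close>. It yields surjectivity and, further
  on, sorted representatives modulo the relations.\<close>

definition ordered_lift :: "(nat multiset \<Rightarrow>\<^sub>0 'k) \<Rightarrow> (free_word \<Rightarrow>\<^sub>0 'k)"
  where "ordered_lift = lin_ext (\<lambda>a. Poly_Mapping.single (FW (sorted_list_of_multiset a)))"

lemma ordered_lift_simps:
  "ordered_lift 0 = 0" "ordered_lift (F + G) = ordered_lift F + ordered_lift G"
  "ordered_lift (Poly_Mapping.single a c) = Poly_Mapping.single (FW (sorted_list_of_multiset a)) c"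
  unfolding ordered_lift_def by (auto simp: lin_ext_single single_add intro!: lin_ext_add)

lemma normal_form_ordered_lift: "normal_form (ordered_lift F) = F"
  by (induction F rule: poly_mapping_additive_induct)
    (auto simp: ordered_lift_simps normal_form_add normal_form_single inversions_sorted)

lemma ordered_lift_closed:
  assumes "F \<in> carrier model"
  shows "ordered_lift F \<in> carrier (free_algebra n)"
proof -
  have "Poly_Mapping.keys (ordered_lift F) \<subseteq> (\<lambda>a. FW (sorted_list_of_multiset a)) ` Poly_Mapping.keys F"
    unfolding ordered_lift_def lin_ext_def
    by (rule order_trans[OF keys_sum] UN_least)+ (auto split: if_splits)
  then show ?thesis
    using assms by (force simp: free_algebra_def model_def monomials_def)
qed

section \<open>The normal form as the quotient map by the relations\<close>

lemma normal_form_surj: "normal_form ` carrier (free_algebra n) = carrier model"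
proof
  show "normal_form ` carrier (free_algebra n) \<subseteq> carrier model"
    using ring_hom_closed[OF ring_hom_ring.homh[OF normal_form_hom]] by auto
  show "carrier model \<subseteq> normal_form ` carrier (free_algebra n)"
    using ordered_lift_closed normal_form_ordered_lift by (metis image_eqI subsetI)
qed

text \<open>For \<open>i < j\<close> only the word \<open>[j, i]\<close> is inverted, at the cost
  \<open>B i j\<close>, which matches the coefficient \<open>p i j\<close>. For \<open>i > j\<close>
  only \<open>[i, j]\<close> is inverted, at the cost \<open>B j i = - B i j\<close>, which cancels
  \<open>p i j\<close>. For \<open>i = j\<close> the coefficient is \<open>1\<close>.\<close>

lemma skew_relations_kernel:
  "skew_relations n p \<subseteq> a_kernel (free_algebra n) model normal_form"
proof
  fix f assume "f \<in> skew_relations n p"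
  then obtain i j where ij: "i \<in> {1..n}" "j \<in> {1..n}"
    and f: "f = Poly_Mapping.single (FW [j, i]) 1 - Poly_Mapping.single (FW [i, j]) (p i j)"
    by (auto simp: skew_relations_def)
  have f': "f = Poly_Mapping.single (FW [j, i]) 1 + Poly_Mapping.single (FW [i, j]) (- p i j)"
    by (simp add: f single_uminus)
  have "Poly_Mapping.keys f \<subseteq> {FW [j, i], FW [i, j]}"
    using keys_add[of "Poly_Mapping.single (FW [j, i]) 1" "Poly_Mapping.single (FW [i, j]) (- p i j)"]
    by (auto simp: f' split: if_splits)
  then have "f \<in> carrier (free_algebra n)"
    using ij by (auto simp: free_algebra_def)
  moreover have "normal_form f = 0"
    unfolding f' normal_form_add normal_form_single using ij
    by (cases i j rule: linorder_cases)
      (auto simp: beta_single p_eq B_diag B_skew[of i j] add_mset_commute power_int_minus simp flip: single_add)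
  ultimately show "f \<in> a_kernel (free_algebra n) model normal_form"
    by (simp add: a_kernel_def' model_def)
qed

text \<open>Modulo the relations every word equals a scalar multiple of its sorted form, so
  \<open>f\<close> is congruent to \<open>ordered_lift (normal_form f)\<close>, which vanishes for
  \<open>f\<close> in the kernel.\<close>

lemma kernel_subset_ideal:
  assumes J: "ideal J (free_algebra n)" and rel: "skew_relations n p \<subseteq> J"
  shows "a_kernel (free_algebra n) model normal_form \<subseteq> J"
proof
  interpret J: ideal J "free_algebra n" by (rule J)
  let ?w = "\<lambda>w c. Poly_Mapping.single (FW w) c :: free_word \<Rightarrow>\<^sub>0 'k"
  have add: "f + g \<in> J" if "f \<in> J" "g \<in> J" for f g
    using additive_subgroup.a_closed[OF J.is_additive_subgroup that] by simp
  have multl: "?w u c * f \<in> J" if "f \<in> J" "set u \<subseteq> {1..n}" for f u c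
    using J.I_l_closed[OF that(1) single_in_free_algebra[OF that(2)]] by simp
  have multr: "f * ?w u c \<in> J" if "f \<in> J" "set u \<subseteq> {1..n}" for f u c
    using J.I_r_closed[OF that(1) single_in_free_algebra[OF that(2)]] by simp
  have zero: "0 \<in> J"
    using additive_subgroup.zero_closed[OF J.is_additive_subgroup] by simp
  \<comment> \<open>Insertion sort, carried out modulo \<open>J\<close>: first a single letter is
    moved into a sorted word, then whole words are sorted letter by letter.\<close>
  have insert: "?w (j # w) c - ?w (insort j w) (c * \<xi> powi beta {#j#} (mset w)) \<in> J"
    if "sorted w" "j \<in> {1..n}" "set w \<subseteq> {1..n}" for j w c
    using that
  proof (induction w arbitrary: c)
    case Nil
    then show ?case using zero by simp
  next
    case (Cons i v)
    show ?case
    proof (cases "j \<le> i")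
      case True
      then have "beta {#j#} (mset (i # v)) = 0" using Cons.prems by (intro beta_least) auto
      then show ?thesis using True zero by simp
    next
      case False
      have i: "i \<in> {1..n}" using Cons.prems by simp
      \<comment> \<open>One relation swaps the two leading letters; the induction hypothesis then
        inserts \<open>j\<close> into the tail behind \<open>i\<close>.\<close>
      have "(?w [j, i] 1 - ?w [i, j] (p i j)) * ?w v c \<in> J"
        using Cons.prems rel i by (intro multr) (auto simp: skew_relations_def)
      then have 1: "?w (j # i # v) c - ?w (i # j # v) (p i j * c) \<in> J"
        by (simp add: left_diff_distrib mult_single plus_free_word_def)
      have "?w [i] 1 * (?w (j # v) (p i j * c) - ?w (insort j v) (p i j * c * \<xi> powi beta {#j#} (mset v))) \<in> J"
        using Cons.prems by (intro multl Cons.IH) auto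
      then have 2: "?w (i # j # v) (p i j * c) - ?w (i # insort j v) (p i j * c * \<xi> powi beta {#j#} (mset v)) \<in> J"
        by (simp add: right_diff_distrib mult_single plus_free_word_def)
      have "beta {#j#} (mset (i # v)) = B i j + beta {#j#} (mset v)"
        using False by (simp add: beta_def)
      then have eq: "c * \<xi> powi beta {#j#} (mset (i # v)) = p i j * c * \<xi> powi beta {#j#} (mset v)"
        using p_eq[OF i Cons.prems(2)] by (simp add: power_int_add)
      show ?thesis unfolding eq using add[OF 1 2] False by simp
    qed
  qed
  have sorting: "?w w c - ?w (sort w) (c * \<xi> powi inversions w) \<in> J" if "set w \<subseteq> {1..n}" for w c
    using that
  proof (induction w)
    case Nil
    then show ?case using zero by simp
  next
    case (Cons j w)
    have "?w [j] 1 * (?w w c - ?w (sort w) (c * \<xi> powi inversions w)) \<in> J"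
      using Cons by (intro multl) auto
    then have 1: "?w (j # w) c - ?w (j # sort w) (c * \<xi> powi inversions w) \<in> J"
      by (simp add: right_diff_distrib mult_single plus_free_word_def)
    have "?w (j # sort w) (c * \<xi> powi inversions w)
        - ?w (insort j (sort w)) (c * \<xi> powi inversions w * \<xi> powi beta {#j#} (mset (sort w))) \<in> J"
      using Cons.prems by (intro insert) auto
    from add[OF 1 this] show ?case by (simp add: power_int_add algebra_simps)
  qed
  fix f assume f: "f \<in> a_kernel (free_algebra n) model normal_form"
  \<comment> \<open>The expression is additive in \<open>f\<close>, so the sorting of single words
    suffices.\<close>
  have "f - ordered_lift (normal_form f) \<in> J"
  proof (induction f rule: poly_mapping_additive_induct)
    case (single u c)
    then have "set (letters u) \<subseteq> {1..n}"
      using f by (auto simp: a_kernel_def' free_algebra_def)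
    then show ?case
      using sorting[of "letters u" c] by (cases u) (simp add: normal_form_single ordered_lift_simps)
  next
    case (add g h)
    then show ?case
      using \<open>\<And>f g. f \<in> J \<Longrightarrow> g \<in> J \<Longrightarrow> f + g \<in> J\<close>[OF add.IH]
      by (simp add: normal_form_add ordered_lift_simps algebra_simps)
  qed (simp add: ordered_lift_simps zero)
  then show "f \<in> J"
    using f by (simp add: a_kernel_def' model_def ordered_lift_simps)
qed

text \<open>This is the basis theorem: \<open>S\<close> becomes the image of the normal form, so the
  ordered monomials are linearly independent in it.\<close>

lemma genideal_skew_relations:
  "genideal (free_algebra n) (skew_relations n p) = a_kernel (free_algebra n) model normal_form"
proof
  interpret F: ring "free_algebra n :: (free_word \<Rightarrow>\<^sub>0 'k) ring" by (rule ring_free_algebra)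
  have carr: "skew_relations n p \<subseteq> carrier (free_algebra n)"
    using skew_relations_kernel by (auto simp: a_kernel_def')
  show "genideal (free_algebra n) (skew_relations n p) \<subseteq> a_kernel (free_algebra n) model normal_form"
    using ring_hom_ring.kernel_is_ideal[OF normal_form_hom] skew_relations_kernel
    by (rule F.genideal_minimal)
  show "a_kernel (free_algebra n) model normal_form \<subseteq> genideal (free_algebra n) (skew_relations n p)"
    by (rule kernel_subset_ideal[OF F.genideal_ideal[OF carr] F.genideal_self[OF carr]])
qed

abbreviation S :: "(free_word \<Rightarrow>\<^sub>0 'k) set ring"
  where "S \<equiv> skew_poly_ring n p"

text \<open>\<open>normal_form\<close> takes a single value on each coset of its kernel; that value
  is the coordinate vector in the monomial basis.\<close>

definition coord :: "(free_word \<Rightarrow>\<^sub>0 'k) set \<Rightarrow> (nat multiset \<Rightarrow>\<^sub>0 'k)"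
  where "coord X = the_elem (normal_form ` X)"

lemma coord_iso: "coord \<in> ring_iso S model"
  using ring_hom_ring.FactRing_iso_set[OF normal_form_hom normal_form_surj]
  by (simp add: skew_poly_ring_def genideal_skew_relations coord_def[abs_def])

lemma ring_S: "ring S"
  unfolding skew_poly_ring_def genideal_skew_relations
  by (rule ideal.quotient_is_ring[OF ring_hom_ring.kernel_is_ideal[OF normal_form_hom]])

lemma coord_skew_var:
  assumes "i \<in> {1..n}"
  shows "skew_var n p i \<in> carrier S" "coord (skew_var n p i) = Poly_Mapping.single {#i#} 1"
proof -
  interpret N: ring_hom_ring "free_algebra n" model normal_form by (rule normal_form_hom)
  have c: "Poly_Mapping.single (FW [i]) (1::'k) \<in> carrier (free_algebra n)"
    using assms by (simp add: single_in_free_algebra)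
  then show "coord (skew_var n p i) = Poly_Mapping.single {#i#} 1"
    by (simp add: coord_def skew_var_def genideal_skew_relations normal_form_single)
  show "skew_var n p i \<in> carrier S"
    using c by (auto simp: skew_var_def skew_poly_ring_def FactRing_def A_RCOSETS_def')
qed

end

section \<open>Coordinates\<close>

text \<open>On \<open>A\<close> the map \<open>h\<close> factors through
  \<open>\<kappa>\<close>.\<close>

lemma finite_image_factor:
  assumes "finite (\<kappa> ` A)" "\<And>a b. a \<in> A \<Longrightarrow> b \<in> A \<Longrightarrow> \<kappa> a = \<kappa> b \<Longrightarrow> h a = h b"
  shows "finite (h ` A)"
proof -
  have "h a = h (inv_into A \<kappa> (\<kappa> a))" if "a \<in> A" for a
    using that assms(2) by (metis f_inv_into_f image_eqI inv_into_into)
  then have "h ` A \<subseteq> (\<lambda>k. h (inv_into A \<kappa> k)) ` \<kappa> ` A"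
    by auto
  then show ?thesis using assms(1) finite_subset by blast
qed

context skew_poly_setting
begin

text \<open>Replacing \<open>c\<close> by its remainder modulo \<open>l\<close> does not change the
  power, and minimality of the order excludes a nonzero remainder.\<close>

lemma xi_powi_eq_1_iff: "\<xi> powi c = 1 \<longleftrightarrow> int l dvd c"
proof -
  have xl: "\<xi> ^ l = 1" and l: "l > 0" and min: "\<And>d. 0 < d \<Longrightarrow> d < l \<Longrightarrow> \<xi> ^ d \<noteq> 1"
    using \<xi>_primitive by (auto simp: primitive_root_of_1_def)
  define r where "r = nat (c mod int l)"
  have r: "int r = c mod int l" "r < l"
    using l by (simp_all add: r_def nat_less_iff)
  have "\<xi> powi c = \<xi> powi (int l * (c div int l) + int r)"
    by (simp add: r)
  also have "\<dots> = \<xi> ^ r"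
    by (simp add: power_int_add power_int_mult xl)
  finally have "\<xi> powi c = 1 \<longleftrightarrow> r = 0"
    using min[of r] r(2) by auto
  then show ?thesis using r(1) by (auto simp: dvd_eq_mod_eq_0)
qed

lemma xi_powi_eq_iff: "\<xi> powi a = \<xi> powi b \<longleftrightarrow> a mod int l = b mod int l"
proof -
  have "\<xi> powi a = \<xi> powi b \<longleftrightarrow> \<xi> powi (a - b) = 1"
    by (simp add: power_int_diff)
  then show ?thesis by (simp add: xi_powi_eq_1_iff mod_eq_dvd_iff)
qed

section \<open>Transport between the quotient ring and its model\<close>

lemma coord_closed: "f \<in> carrier S \<Longrightarrow> coord f \<in> carrier model"
  and coord_mult: "\<lbrakk>f \<in> carrier S; g \<in> carrier S\<rbrakk> \<Longrightarrow> coord (f \<otimes>\<^bsub>S\<^esub> g) = coord f \<star> coord g"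
  and coord_add: "\<lbrakk>f \<in> carrier S; g \<in> carrier S\<rbrakk> \<Longrightarrow> coord (f \<oplus>\<^bsub>S\<^esub> g) = coord f + coord g"
  and coord_bij: "bij_betw coord (carrier S) (carrier model)"
  using ring_iso_memE[OF coord_iso] by auto

lemma coord_inject: "\<lbrakk>f \<in> carrier S; g \<in> carrier S\<rbrakk> \<Longrightarrow> coord f = coord g \<longleftrightarrow> f = g"
  using coord_bij by (auto simp: bij_betw_def inj_on_def)

lemma coord_finsum:
  assumes "f \<in> A \<rightarrow> carrier S"
  shows "coord (\<Oplus>\<^bsub>S\<^esub>i\<in>A. f i) = (\<Sum>i\<in>A. coord (f i))"
proof -
  interpret S: ring S by (rule ring_S)
  have "coord \<zero>\<^bsub>S\<^esub> = 0"
    using coord_add[of "\<zero>\<^bsub>S\<^esub>" "\<zero>\<^bsub>S\<^esub>"] by simp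
  then show ?thesis using assms
    by (induction A rule: infinite_finite_induct) (simp_all add: coord_add Pi_def)
qed

definition of_coord :: "(nat multiset \<Rightarrow>\<^sub>0 'k) \<Rightarrow> (free_word \<Rightarrow>\<^sub>0 'k) set"
  where "of_coord = inv_into (carrier S) coord"

lemma of_coord_closed: "F \<in> carrier model \<Longrightarrow> of_coord F \<in> carrier S"
  and coord_of_coord: "F \<in> carrier model \<Longrightarrow> coord (of_coord F) = F"
  and of_coord_coord: "f \<in> carrier S \<Longrightarrow> of_coord (coord f) = f"
  using coord_bij unfolding of_coord_def
  by (metis bij_betw_def inv_into_into, metis bij_betw_inv_into_right, metis bij_betw_inv_into_left)

lemma carrier_model_simps [simp]:
  "0 \<in> carrier model"
  "F \<in> carrier model \<Longrightarrow> G \<in> carrier model \<Longrightarrow> F + G \<in> carrier model"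
  "F \<in> carrier model \<Longrightarrow> G \<in> carrier model \<Longrightarrow> F \<star> G \<in> carrier model"
  "a \<in> monomials \<Longrightarrow> Poly_Mapping.single a c \<in> carrier model"
proof -
  interpret M: ring model by (rule ring_model)
  show "0 \<in> carrier model"
    "F \<in> carrier model \<Longrightarrow> G \<in> carrier model \<Longrightarrow> F + G \<in> carrier model"
    "F \<in> carrier model \<Longrightarrow> G \<in> carrier model \<Longrightarrow> F \<star> G \<in> carrier model"
    using M.zero_closed M.a_closed[of F G] M.m_closed[of F G] by simp_all
qed (simp add: carrier_model)

lemma carrier_model_sum:
  "(\<And>i. i \<in> A \<Longrightarrow> F i \<in> carrier model) \<Longrightarrow> (\<Sum>i\<in>A. F i) \<in> carrier model"
  by (induction A rule: infinite_finite_induct) auto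

lemma star_sum_left: "(\<Sum>i\<in>A. F i) \<star> G = (\<Sum>i\<in>A. F i \<star> G)"
  by (induction A rule: infinite_finite_induct) (simp_all add: star_add_left)

lemma star_sum_right: "F \<star> (\<Sum>i\<in>A. G i) = (\<Sum>i\<in>A. F \<star> G i)"
  by (induction A rule: infinite_finite_induct) (simp_all add: star_add_right)

text \<open>Addition of exponents is cancellative, so only the term of \<open>F\<close> at
  \<open>b\<close> contributes to the coefficient at \<open>a + b\<close>.\<close>

lemma lookup_single_star:
  "Poly_Mapping.lookup (Poly_Mapping.single a c \<star> F) (a + b) = c * \<xi> powi beta a b * Poly_Mapping.lookup F b"
  by (induction F rule: poly_mapping_additive_induct)
    (simp_all add: star_add_right lookup_add lookup_single when_def algebra_simps)

lemma lookup_star_single: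
  "Poly_Mapping.lookup (F \<star> Poly_Mapping.single a c) (b + a) = Poly_Mapping.lookup F b * c * \<xi> powi beta b a"
  by (induction F rule: poly_mapping_additive_induct)
    (simp_all add: star_add_left lookup_add lookup_single when_def algebra_simps)

lemma single_star_cancel:
  assumes "Poly_Mapping.single a c \<star> F = Poly_Mapping.single a c \<star> G" "c \<noteq> 0"
  shows "F = G"
proof (rule poly_mapping_eqI)
  show "Poly_Mapping.lookup F b = Poly_Mapping.lookup G b" for b
    using lookup_single_star[of a c F b] lookup_single_star[of a c G b] assms by simp
qed

lemma star_single_cancel:
  assumes "F \<star> Poly_Mapping.single a c = G \<star> Poly_Mapping.single a c" "c \<noteq> 0"
  shows "F = G"
proof (rule poly_mapping_eqI)
  show "Poly_Mapping.lookup F b = Poly_Mapping.lookup G b" for b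
    using lookup_star_single[of F a c b] lookup_star_single[of G a c b] assms by simp
qed

section \<open>The group of conjugations\<close>

text \<open>The commutation pairing: \<open>x^a x^m\<close> is \<open>\<xi> powi omega m a\<close>
  times \<open>x^m x^a\<close>. With \<open>m = {#i#}\<close> it is the \<open>i\<close>-th entry of
  the vector \<open>B a\<close>.\<close>

definition omega :: "nat multiset \<Rightarrow> nat multiset \<Rightarrow> int"
  where "omega m a = (\<Sum>i\<in>#m. \<Sum>s\<in>#a. B i s)"

lemma omega_simps [simp]:
  "omega (m + m') a = omega m a + omega m' a" "omega m (a + a') = omega m a + omega m a'"
  "omega {#} a = 0" "omega m {#} = 0"
  by (simp_all add: omega_def sum_mset.distrib)

lemma omega_add_mset:
  "omega (add_mset i m) a = omega {#i#} a + omega m a" "omega m (add_mset i a) = omega m {#i#} + omega m a"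
  using omega_simps(1)[of "{#i#}" m a] omega_simps(2)[of m "{#i#}" a] by simp_all

lemma omega_repeat [simp]:
  "omega (repeat_mset k m) a = int k * omega m a" "omega m (repeat_mset k a) = int k * omega m a"
  by (induction k) (simp_all add: algebra_simps)

lemma repeat_mset_monomials: "m \<in> monomials \<Longrightarrow> repeat_mset k m \<in> monomials"
  by (induction k) simp_all

text \<open>All three terms are additive in both arguments, which leaves single letters, where skew
  symmetry of \<open>B\<close> decides each of the three orderings.\<close>

lemma beta_commute:
  assumes "m \<in> monomials" "a \<in> monomials"
  shows "beta m a + omega m a = beta a m"
  using assms
proof (induction m)
  case (add i m)
  have "beta {#i#} a + omega {#i#} a = beta a {#i#}"
    using add.prems(2)
  proof (induction a)
    case (add s a)
    have "beta {#i#} {#s#} + omega {#i#} {#s#} = beta {#s#} {#i#}"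
      using add.prems \<open>add_mset i m \<in> monomials\<close> B_diag[of i] B_skew[of i s]
      by (cases i s rule: linorder_cases) (auto simp: beta_single omega_def)
    moreover have "beta {#i#} a + omega {#i#} a = beta a {#i#}"
      using add by simp
    ultimately show ?case
      unfolding beta_add_mset(2)[of "{#i#}" s a] beta_add_mset(1)[of s a "{#i#}"]
        omega_add_mset(2)[of "{#i#}" s a] by linarith
  qed simp
  then show ?case
    using add by (simp add: beta_add_mset(1)[of i m a] beta_add_mset(2)[of a i m] omega_add_mset(1)[of i m a])
qed simp

lemma omega_skew:
  assumes "m \<in> monomials" "a \<in> monomials"
  shows "omega a m = - omega m a"
  using beta_commute[OF assms] beta_commute[OF assms(2,1)] by simp

section \<open>Diagonal maps and conjugation by monomials\<close>

definition diag :: "(nat multiset \<Rightarrow> 'k) \<Rightarrow> (nat multiset \<Rightarrow>\<^sub>0 'k) \<Rightarrow> (nat multiset \<Rightarrow>\<^sub>0 'k)"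
  where "diag \<chi> = lin_ext (\<lambda>a c. Poly_Mapping.single a (\<chi> a * c))"

lemma diag_simps [simp]:
  "diag \<chi> 0 = 0" "diag \<chi> (F + G) = diag \<chi> F + diag \<chi> G"
  "diag \<chi> (Poly_Mapping.single a c) = Poly_Mapping.single a (\<chi> a * c)"
  unfolding diag_def by (auto simp: lin_ext_single distrib_left single_add intro!: lin_ext_add)

lemma lookup_diag [simp]: "Poly_Mapping.lookup (diag \<chi> F) a = \<chi> a * Poly_Mapping.lookup F a"
  by (induction F rule: poly_mapping_additive_induct)
    (simp_all add: lookup_add lookup_single when_def distrib_left)

lemma diag_closed [simp]: "F \<in> carrier model \<Longrightarrow> diag \<chi> F \<in> carrier model"
  by (auto simp: carrier_model in_keys_iff)

lemma diag_cong:
  assumes "F \<in> carrier model" "\<And>a. a \<in> monomials \<Longrightarrow> \<chi> a = \<chi>' a"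
  shows "diag \<chi> F = diag \<chi>' F"
proof (rule poly_mapping_eqI)
  show "Poly_Mapping.lookup (diag \<chi> F) a = Poly_Mapping.lookup (diag \<chi>' F) a" for a
    using assms by (cases "a \<in> Poly_Mapping.keys F") (auto simp: carrier_model in_keys_iff)
qed

definition chi :: "nat multiset \<Rightarrow> nat multiset \<Rightarrow> 'k"
  where "chi m a = \<xi> powi omega m a"

lemma chi_simps [simp]:
  "chi (m + m') a = chi m a * chi m' a" "chi m (a + a') = chi m a * chi m a'"
  "chi {#} a = 1" "chi m {#} = 1" "chi m a \<noteq> 0"
  by (simp_all add: chi_def power_int_add)

lemma chi_repeat_l [simp]: "chi (repeat_mset l m) a = 1"
  by (simp add: chi_def xi_powi_eq_1_iff)

lemma diag_chi_star: "diag (chi m) (F \<star> G) = diag (chi m) F \<star> diag (chi m) G"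
proof (induction F rule: poly_mapping_additive_induct)
  case (single a c)
  show ?case
    by (induction G rule: poly_mapping_additive_induct) (simp_all add: star_add_right algebra_simps)
qed (simp_all add: star_add_left)

text \<open>The equation \<open>x^m g = f x^m\<close> that characterises conjugation by
  \<open>x^m\<close>; on monomials it is \<open>beta_commute\<close>.\<close>

lemma single_star_diag:
  assumes "m \<in> monomials" "F \<in> carrier model"
  shows "Poly_Mapping.single m 1 \<star> diag (chi m) F = F \<star> Poly_Mapping.single m 1"
proof (induction F rule: poly_mapping_additive_induct)
  case (single a c)
  then have "a \<in> monomials" using assms(2) by (auto simp: carrier_model)
  then show ?case
    using beta_commute[OF assms(1), of a] by (simp add: chi_def add.commute flip: power_int_add)
      (simp add: algebra_simps power_int_add flip: beta_commute[OF assms(1), of a])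
qed (simp_all add: star_add_left star_add_right)

text \<open>Conjugation \<open>f \<mapsto> x^(-m) f x^m\<close> by the monomial \<open>x^m\<close>,
  made extensional on \<open>carrier S\<close> to match \<open>BijGroup\<close>.\<close>

definition theta :: "nat multiset \<Rightarrow> (free_word \<Rightarrow>\<^sub>0 'k) set \<Rightarrow> (free_word \<Rightarrow>\<^sub>0 'k) set"
  where "theta m = (\<lambda>f\<in>carrier S. of_coord (diag (chi m) (coord f)))"

lemma theta_closed: "f \<in> carrier S \<Longrightarrow> theta m f \<in> carrier S"
  and coord_theta: "f \<in> carrier S \<Longrightarrow> coord (theta m f) = diag (chi m) (coord f)"
  by (simp_all add: theta_def of_coord_closed coord_of_coord coord_closed)

lemma theta_compose: "compose (carrier S) (theta m) (theta m') = theta (m + m')"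
proof
  fix f
  show "compose (carrier S) (theta m) (theta m') f = theta (m + m') f"
  proof (cases "f \<in> carrier S")
    case True
    have "diag (chi m) (diag (chi m') (coord f)) = diag (chi (m + m')) (coord f)"
      by (rule poly_mapping_eqI) simp
    then show ?thesis
      using True by (simp add: compose_def theta_def of_coord_closed coord_of_coord coord_closed)
  qed (simp add: compose_def theta_def)
qed

lemma theta_id: "(\<And>a. chi m a = 1) \<Longrightarrow> theta m = (\<lambda>f\<in>carrier S. f)"
proof
  fix f assume "\<And>a. chi m a = 1"
  then have "diag (chi m) (coord f) = coord f"
    by (intro poly_mapping_eqI) simp
  then show "theta m f = (\<lambda>f\<in>carrier S. f) f"
    by (simp add: theta_def of_coord_coord)
qed

text \<open>As \<open>\<xi>\<close> has order \<open>l\<close>, the \<open>l\<close>-fold iterate of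
  \<open>theta m\<close> is the identity, so the inverse is the \<open>(l - 1)\<close>-fold
  iterate.\<close>

lemma theta_inverse:
  "compose (carrier S) (theta (repeat_mset (l - 1) m)) (theta m) = (\<lambda>f\<in>carrier S. f)"
  "compose (carrier S) (theta m) (theta (repeat_mset (l - 1) m)) = (\<lambda>f\<in>carrier S. f)"
proof -
  have "repeat_mset (l - 1) m + m = repeat_mset l m"
    using l_gt_1 by (intro multiset_eqI) (cases l, auto)
  then show "compose (carrier S) (theta (repeat_mset (l - 1) m)) (theta m) = (\<lambda>f\<in>carrier S. f)"
    "compose (carrier S) (theta m) (theta (repeat_mset (l - 1) m)) = (\<lambda>f\<in>carrier S. f)"
    by (simp_all add: theta_compose theta_id add.commute)
qed

lemma theta_Bij: "theta m \<in> Bij (carrier S)"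
proof -
  have "bij_betw (theta m) (carrier S) (carrier S)"
  proof (rule bij_betw_byWitness[of _ "theta (repeat_mset (l - 1) m)"])
    show "\<forall>f\<in>carrier S. theta (repeat_mset (l - 1) m) (theta m f) = f"
    proof
      show "theta (repeat_mset (l - 1) m) (theta m f) = f" if "f \<in> carrier S" for f
        using fun_cong[OF theta_inverse(1)[of m], of f] that by (simp add: compose_def)
    qed
    show "\<forall>f\<in>carrier S. theta m (theta (repeat_mset (l - 1) m) f) = f"
    proof
      show "theta m (theta (repeat_mset (l - 1) m) f) = f" if "f \<in> carrier S" for f
        using fun_cong[OF theta_inverse(2)[of m], of f] that by (simp add: compose_def)
    qed
  qed (auto simp: theta_closed)
  then show ?thesis by (simp add: Bij_def theta_def)
qed

lemma theta_hom: "theta m \<in> ring_hom S S"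
proof (rule ring_hom_memI)
  interpret S: ring S by (rule ring_S)
  fix f g assume fg: "f \<in> carrier S" "g \<in> carrier S"
  show "theta m f \<in> carrier S" using fg by (simp add: theta_closed)
  have "coord (theta m (f \<otimes>\<^bsub>S\<^esub> g)) = coord (theta m f \<otimes>\<^bsub>S\<^esub> theta m g)"
    using fg by (simp add: coord_theta coord_mult theta_closed diag_chi_star)
  then show "theta m (f \<otimes>\<^bsub>S\<^esub> g) = theta m f \<otimes>\<^bsub>S\<^esub> theta m g"
    using fg by (simp add: coord_inject theta_closed)
  have "coord (theta m (f \<oplus>\<^bsub>S\<^esub> g)) = coord (theta m f \<oplus>\<^bsub>S\<^esub> theta m g)"
    using fg by (simp add: coord_theta coord_add theta_closed)
  then show "theta m (f \<oplus>\<^bsub>S\<^esub> g) = theta m f \<oplus>\<^bsub>S\<^esub> theta m g"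
    using fg by (simp add: coord_inject theta_closed)
next
  interpret S: ring S by (rule ring_S)
  have 1: "coord \<one>\<^bsub>S\<^esub> = 1"
    using ring_hom_one[of coord S model] coord_iso by (simp add: ring_iso_def)
  have "coord (theta m \<one>\<^bsub>S\<^esub>) = coord \<one>\<^bsub>S\<^esub>"
    using diag_simps(3)[of "chi m" 0 1] by (simp add: coord_theta 1)
  then show "theta m \<one>\<^bsub>S\<^esub> = \<one>\<^bsub>S\<^esub>" by (simp add: coord_inject theta_closed)
qed

text \<open>\<open>theta {#i#} f\<close> solves the defining equation, and left cancellation of
  \<open>x_i\<close> makes the solution unique.\<close>

lemma conj_aut_eq_theta:
  assumes "i \<in> {1..n}"
  shows "conj_aut n p i = theta {#i#}"
proof
  interpret S: ring S by (rule ring_S)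
  note x = coord_skew_var[OF assms]
  fix f
  show "conj_aut n p i f = theta {#i#} f"
  proof (cases "f \<in> carrier S")
    case True
    have iff: "skew_var n p i \<otimes>\<^bsub>S\<^esub> g = f \<otimes>\<^bsub>S\<^esub> skew_var n p i \<longleftrightarrow> g = theta {#i#} f"
      if g: "g \<in> carrier S" for g
    proof -
      have "skew_var n p i \<otimes>\<^bsub>S\<^esub> g = f \<otimes>\<^bsub>S\<^esub> skew_var n p i \<longleftrightarrow>
          coord (skew_var n p i \<otimes>\<^bsub>S\<^esub> g) = coord (f \<otimes>\<^bsub>S\<^esub> skew_var n p i)"
        using x True g by (simp add: coord_inject)
      also have "\<dots> \<longleftrightarrow> Poly_Mapping.single {#i#} 1 \<star> coord g
          = Poly_Mapping.single {#i#} 1 \<star> diag (chi {#i#}) (coord f)"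
        using x True g assms by (simp add: coord_mult single_star_diag coord_closed)
      also have "\<dots> \<longleftrightarrow> coord g = coord (theta {#i#} f)"
        using True single_star_cancel[of "{#i#}" 1] by (auto simp: coord_theta)
      finally show ?thesis using g True by (simp add: coord_inject theta_closed)
    qed
    then have "(THE g. g \<in> carrier S \<and> skew_var n p i \<otimes>\<^bsub>S\<^esub> g = f \<otimes>\<^bsub>S\<^esub> skew_var n p i) = theta {#i#} f"
      using theta_closed[OF True] by (intro the_equality) auto
    then show ?thesis using True by (simp add: conj_aut_def Let_def)
  qed (simp add: conj_aut_def theta_def Let_def)
qed

abbreviation G :: "((free_word \<Rightarrow>\<^sub>0 'k) set \<Rightarrow> (free_word \<Rightarrow>\<^sub>0 'k) set) set"
  where "G \<equiv> conj_group n p"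

text \<open>Composition of the maps \<open>theta m\<close> adds exponents and inversion multiplies
  them by \<open>l - 1\<close>, so no negative exponents are needed to describe the generated
  group.\<close>

lemma conj_group_eq: "G = theta ` monomials"
proof -
  let ?G = "BijGroup (carrier S)"
  interpret Bg: group ?G by (rule group_BijGroup)
  have mult: "theta m \<otimes>\<^bsub>?G\<^esub> theta m' = theta (m + m')" for m m'
    by (simp add: BijGroup_def theta_Bij theta_compose)
  have one: "\<one>\<^bsub>?G\<^esub> = theta {#}"
    by (simp add: BijGroup_def theta_id)
  have carr: "theta m \<in> carrier ?G" for m
    by (simp add: BijGroup_def theta_Bij)
  have inv: "inv\<^bsub>?G\<^esub> theta m = theta (repeat_mset (l - 1) m)" for m
  proof (rule Bg.inv_equality)
    show "theta (repeat_mset (l - 1) m) \<otimes>\<^bsub>?G\<^esub> theta m = \<one>\<^bsub>?G\<^esub>"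
      using theta_inverse(1)[of m] by (simp add: BijGroup_def theta_Bij)
  qed (rule carr)+
  have gen: "conj_aut n p ` {1..n} = (\<lambda>i. theta {#i#}) ` {1..n}"
    by (simp add: conj_aut_eq_theta)
  show ?thesis
  proof
    show "G \<subseteq> theta ` monomials"
    proof
      fix g assume "g \<in> G"
      then have "g \<in> generate ?G ((\<lambda>i. theta {#i#}) ` {1..n})"
        by (simp only: conj_group_def gen)
      then show "g \<in> theta ` monomials"
      proof induction
        case one
        then show ?case using \<open>\<one>\<^bsub>?G\<^esub> = theta {#}\<close> by auto
      next
        case (incl h)
        then show ?case by auto
      next
        case (inv h)
        then obtain i where i: "i \<in> {1..n}" "h = theta {#i#}" by auto
        then show ?case
          using \<open>\<And>m. inv\<^bsub>?G\<^esub> theta m = theta (repeat_mset (l - 1) m)\<close> repeat_mset_monomials[of "{#i#}"] by auto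
      next
        case (eng h1 h2)
        then obtain m1 m2 where "m1 \<in> monomials" "m2 \<in> monomials" "h1 = theta m1" "h2 = theta m2" by auto
        then show ?case using mult by (auto intro!: image_eqI[of _ _ "m1 + m2"])
      qed
    qed
    have "theta m \<in> generate ?G ((\<lambda>i. theta {#i#}) ` {1..n})" if "m \<in> monomials" for m
      using that
    proof (induction m)
      case empty
      show ?case using generate.one[of ?G] one by simp
    next
      case (add i m)
      then have "theta {#i#} \<otimes>\<^bsub>?G\<^esub> theta m \<in> generate ?G ((\<lambda>i. theta {#i#}) ` {1..n})"
        by (intro generate.eng[OF generate.incl]) auto
      then show ?case by (simp add: mult)
    qed
    then show "theta ` monomials \<subseteq> G"
      unfolding conj_group_def gen by auto
  qed
qed

text \<open>The vector \<open>B a\<close> modulo \<open>l\<close>. It labels the isotypic component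
  containing \<open>x^a\<close>; restriction to \<open>{1..n}\<close> leaves finitely many
  values.\<close>

definition cls :: "nat multiset \<Rightarrow> nat \<Rightarrow> int"
  where "cls a = (\<lambda>i\<in>{1..n}. omega {#i#} a mod int l)"

lemma finite_cls: "finite (cls ` A)"
proof (rule finite_subset)
  show "cls ` A \<subseteq> {1..n} \<rightarrow>\<^sub>E {0..<int l}"
    using l_gt_1 by (auto simp: cls_def)
qed (simp add: finite_PiE)

lemma cls_eqD:
  assumes "cls a = cls b" "i \<in> {1..n}"
  shows "omega {#i#} a mod int l = omega {#i#} b mod int l"
proof -
  have "cls a i = cls b i" using assms(1) by simp
  then show ?thesis using assms(2) by (simp add: cls_def)
qed

lemma chi_cong_right:
  assumes "cls a = cls b" "m \<in> monomials"
  shows "chi m a = chi m b"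
  using assms(2)
proof (induction m)
  case (add i m)
  then have "chi {#i#} a = chi {#i#} b"
    using cls_eqD[OF assms(1), of i] by (simp add: chi_def xi_powi_eq_iff)
  then show ?case using add chi_simps(1)[of "{#i#}" m] by simp
qed simp

text \<open>Skew symmetry of \<open>omega\<close> exchanges the two arguments.\<close>

lemma chi_cong_left:
  assumes "cls m = cls m'" "m \<in> monomials" "m' \<in> monomials" "a \<in> monomials"
  shows "chi m a = chi m' a"
  using chi_cong_right[OF assms(1,4)] omega_skew[OF assms(2,4)] omega_skew[OF assms(3,4)]
  by (simp add: chi_def power_int_minus)

lemma cls_eqI:
  assumes "\<And>i. i \<in> {1..n} \<Longrightarrow> chi {#i#} a = chi {#i#} b"
  shows "cls a = cls b"
  unfolding cls_def using assms by (intro restrict_ext) (simp add: chi_def xi_powi_eq_iff)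

lemma cls_add:
  assumes "cls a = cls b" "cls a' = cls b'"
  shows "cls (a + a') = cls (b + b')"
proof (rule cls_eqI)
  show "chi {#i#} (a + a') = chi {#i#} (b + b')" if "i \<in> {1..n}" for i
    using chi_cong_right[OF assms(1), of "{#i#}"] chi_cong_right[OF assms(2), of "{#i#}"] that by simp
qed

text \<open>\<open>theta m\<close> depends only on \<open>cls m\<close>, and there are finitely many
  classes.\<close>

lemma finite_conj_group: "finite G"
  unfolding conj_group_eq
proof (rule finite_image_factor[OF finite_cls])
  fix m m' assume "m \<in> monomials" "m' \<in> monomials" "cls m = cls m'"
  then have "diag (chi m) (coord f) = diag (chi m') (coord f)" if "f \<in> carrier S" for f
    using that by (intro diag_cong coord_closed chi_cong_left)
  then show "theta m = theta m'"
    unfolding theta_def by (intro restrict_ext) simp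
qed

lemma ring_aut_group_conj_group: "ring_aut_group S G"
proof (intro ring_aut_group.intro ring_aut_group_axioms.intro ring_S finite_conj_group)
  show "(\<lambda>r\<in>carrier S. r) \<in> G"
    using theta_id[of "{#}"] by (auto simp: conj_group_eq intro!: image_eqI[of _ _ "{#}"])
  fix g assume g: "g \<in> G"
  then show "g \<in> ring_hom S S" "g \<in> Bij (carrier S)"
    by (auto simp: conj_group_eq theta_hom theta_Bij)
  fix h assume "h \<in> G"
  with g show "compose (carrier S) g h \<in> G"
    by (auto simp: conj_group_eq theta_compose)
qed

end

section \<open>Surjectivity of the Auslander map\<close>

text \<open>Dedekind's argument on the submonoid \<open>M\<close>: from the relation at
  \<open>a + b\<close> subtract \<open>\<chi> h b\<close> times the relation at \<open>a\<close>.
  This removes \<open>h\<close> and gives a shorter relation.\<close>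

lemma characters_independent:
  fixes \<chi> :: "'g \<Rightarrow> 'a::comm_monoid_add \<Rightarrow> 'k::field"
  assumes "finite A"
    and M: "0 \<in> M" "\<And>a b. a \<in> M \<Longrightarrow> b \<in> M \<Longrightarrow> a + b \<in> M"
    and mult: "\<And>g a b. g \<in> A \<Longrightarrow> a \<in> M \<Longrightarrow> b \<in> M \<Longrightarrow> \<chi> g (a + b) = \<chi> g a * \<chi> g b"
    and one: "\<And>g. g \<in> A \<Longrightarrow> \<chi> g 0 = 1"
    and distinct: "\<And>g h. g \<in> A \<Longrightarrow> h \<in> A \<Longrightarrow> g \<noteq> h \<Longrightarrow> \<exists>a\<in>M. \<chi> g a \<noteq> \<chi> h a"
    and zero: "\<And>a. a \<in> M \<Longrightarrow> (\<Sum>g\<in>A. c g * \<chi> g a) = 0"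
    and "g \<in> A"
  shows "c g = 0"
  using \<open>finite A\<close> mult one distinct zero \<open>g \<in> A\<close>
proof (induction A arbitrary: c g rule: finite_induct)
  case (insert h A)
  have rest: "c k = 0" if k: "k \<in> A" for k
  proof -
    \<comment> \<open>The shift \<open>b\<close> separates \<open>k\<close> from \<open>h\<close>,
      so the coefficient of \<open>k\<close> survives the elimination up to a nonzero
      factor.\<close>
    obtain b where b: "b \<in> M" "\<chi> k b \<noteq> \<chi> h b"
      using insert.prems(3)[of k h] insert.hyps(2) k by auto
    have "c k * (\<chi> k b - \<chi> h b) = 0"
    proof (rule insert.IH[where c = "\<lambda>k. c k * (\<chi> k b - \<chi> h b)"])
      fix a assume a: "a \<in> M"
      have "0 = (\<Sum>g\<in>insert h A. c g * \<chi> g (a + b)) - \<chi> h b * (\<Sum>g\<in>insert h A. c g * \<chi> g a)"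
        using insert.prems(4) M(2) a b(1) by simp
      also have "\<dots> = (\<Sum>g\<in>insert h A. c g * (\<chi> g b - \<chi> h b) * \<chi> g a)"
        unfolding sum_distrib_left sum_subtractf[symmetric]
        using insert.prems(1) a b(1) by (intro sum.cong) (simp_all add: algebra_simps)
      also have "\<dots> = (\<Sum>g\<in>A. c g * (\<chi> g b - \<chi> h b) * \<chi> g a)"
        using insert.hyps by simp
      finally show "(\<Sum>g\<in>A. c g * (\<chi> g b - \<chi> h b) * \<chi> g a) = 0" by simp
    qed (use insert.prems k in auto)
    then show ?thesis using b(2) by simp
  qed
  \<comment> \<open>With all other coefficients zero, evaluation at \<open>0\<close> isolates that
    of \<open>h\<close>.\<close>
  have "(\<Sum>k\<in>insert h A. c k * \<chi> k 0) = c h"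
    using insert.hyps insert.prems(2) rest by simp
  then have "c h = 0" using insert.prems(4)[OF M(1)] by simp
  then show ?case using rest insert.prems(5) by auto
qed simp

context skew_poly_setting
begin

section \<open>Characters of the group, and injectivity of the Auslander map\<close>

interpretation S: ring_aut_group S G
  by (rule ring_aut_group_conj_group)

text \<open>The eigenvalue of \<open>g\<close> on \<open>x^a\<close>, read off from \<open>g\<close>
  itself since an \<open>m\<close> with \<open>g = theta m\<close> is not unique.\<close>

definition ev :: "((free_word \<Rightarrow>\<^sub>0 'k) set \<Rightarrow> (free_word \<Rightarrow>\<^sub>0 'k) set) \<Rightarrow> nat multiset \<Rightarrow> 'k"
  where "ev g a = Poly_Mapping.lookup (coord (g (of_coord (Poly_Mapping.single a 1)))) a"

lemma ev_theta: "a \<in> monomials \<Longrightarrow> ev (theta m) a = chi m a"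
  by (simp add: ev_def coord_theta of_coord_closed coord_of_coord)

lemma coord_conj:
  assumes "g \<in> G" "f \<in> carrier S"
  shows "coord (g f) = diag (ev g) (coord f)"
proof -
  obtain m where "g = theta m" using assms(1) by (auto simp: conj_group_eq)
  then show ?thesis
    using assms(2) by (simp add: coord_theta) (intro diag_cong coord_closed; simp add: ev_theta)
qed

lemma ev_add: "\<lbrakk>g \<in> G; a \<in> monomials; b \<in> monomials\<rbrakk> \<Longrightarrow> ev g (a + b) = ev g a * ev g b"
  and ev_0: "g \<in> G \<Longrightarrow> ev g {#} = 1"
  and ev_nonzero: "\<lbrakk>g \<in> G; a \<in> monomials\<rbrakk> \<Longrightarrow> ev g a \<noteq> 0"
  by (auto simp: conj_group_eq ev_theta)

lemma ev_compose:
  "\<lbrakk>g \<in> G; h \<in> G; a \<in> monomials\<rbrakk> \<Longrightarrow> ev (compose (carrier S) g h) a = ev g a * ev h a"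
  by (auto simp: conj_group_eq ev_theta theta_compose)

lemma ev_cong:
  assumes "g \<in> G" "a \<in> monomials" "b \<in> monomials" "cls a = cls b"
  shows "ev g a = ev g b"
  using assms chi_cong_right[OF assms(4)] by (auto simp: conj_group_eq ev_theta)

lemma ev_inject:
  assumes "g \<in> G" "h \<in> G" "\<And>a. a \<in> monomials \<Longrightarrow> ev g a = ev h a"
  shows "g = h"
proof
  fix f
  show "g f = h f"
  proof (cases "f \<in> carrier S")
    case True
    then have "coord (g f) = coord (h f)"
      using assms by (simp add: coord_conj) (intro diag_cong coord_closed; simp)
    then show ?thesis using True assms by (simp add: coord_inject)
  next
    case False
    then show ?thesis using S.Bij[OF assms(1)] S.Bij[OF assms(2)]
      by (simp add: Bij_def extensional_def)
  qed
qed

text \<open>Orthogonality of characters: if the classes differ, some conjugation \<open>h\<close>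
  separates \<open>a\<close> from \<open>b\<close>, and translating the sum by \<open>h\<close>
  multiplies it by a scalar other than \<open>1\<close>.\<close>

lemma sum_ev:
  assumes a: "a \<in> monomials" and b: "b \<in> monomials"
  shows "(\<Sum>g\<in>G. ev g a / ev g b) = (if cls a = cls b then of_nat (card G) else 0)"
proof (cases "cls a = cls b")
  case True
  then have "(\<Sum>g\<in>G. ev g a / ev g b) = (\<Sum>g\<in>G. 1)"
    using ev_cong[OF _ a b] ev_nonzero b by (intro sum.cong) auto
  then show ?thesis using True by simp
next
  case False
  then obtain i where i: "i \<in> {1..n}" "chi {#i#} a \<noteq> chi {#i#} b"
    using cls_eqI by blast
  define h where "h = theta {#i#}"
  have h: "h \<in> G" using i(1) by (auto simp: h_def conj_group_eq)
  define s where "s = (\<Sum>g\<in>G. ev g a / ev g b)"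
  have "inj_on (compose (carrier S) h) G"
  proof (rule inj_onI)
    fix g g' assume g: "g \<in> G" "g' \<in> G" "compose (carrier S) h g = compose (carrier S) h g'"
    show "g = g'"
    proof (rule ev_inject[OF g(1,2)])
      fix c assume "c \<in> monomials"
      then show "ev g c = ev g' c"
        using ev_compose[OF h g(1)] ev_compose[OF h g(2)] g(3) ev_nonzero[OF h] by simp
    qed
  qed
  then have "bij_betw (compose (carrier S) h) G G"
    using S.comp_mem[OF h] endo_inj_surj[OF S.finite_G] by (simp add: bij_betw_def image_subset_iff)
  then have "s = (\<Sum>g\<in>G. ev (compose (carrier S) h g) a / ev (compose (carrier S) h g) b)"
    unfolding s_def by (rule sum.reindex_bij_betw[symmetric])
  also have "\<dots> = chi {#i#} a / chi {#i#} b * s"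
    unfolding s_def sum_distrib_left
    using h a b by (intro sum.cong) (auto simp: ev_compose, simp add: h_def ev_theta)
  finally have "s * (chi {#i#} a / chi {#i#} b - 1) = 0" by (simp add: algebra_simps)
  then have "s = 0" using i(2) by auto
  then show ?thesis using False by (simp add: s_def)
qed

lemma coord_auslander_map:
  assumes "u \<in> G \<rightarrow>\<^sub>E carrier S" "b \<in> carrier S"
  shows "coord (auslander_map S G u b) = (\<Sum>g\<in>G. coord (u g) \<star> diag (ev g) (coord b))"
proof -
  have "coord (auslander_map S G u b) = (\<Sum>g\<in>G. coord (u g \<otimes>\<^bsub>S\<^esub> g b))"
    unfolding auslander_map_def using assms by (simp, subst coord_finsum) auto
  also have "\<dots> = (\<Sum>g\<in>G. coord (u g) \<star> diag (ev g) (coord b))"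
  proof (rule sum.cong)
    fix g assume g: "g \<in> G"
    then have "u g \<in> carrier S" using assms(1) by auto
    then show "coord (u g \<otimes>\<^bsub>S\<^esub> g b) = coord (u g) \<star> diag (ev g) (coord b)"
      using g assms(2) by (simp add: coord_mult coord_conj)
  qed simp
  finally show ?thesis .
qed

text \<open>The coefficient at \<open>b + a\<close> of the image of \<open>x^a\<close> involves only
  the coefficients of the \<open>u g\<close> at \<open>b\<close>. Letting \<open>a\<close> vary
  gives a linear relation between the characters \<open>ev g\<close>.\<close>

lemma auslander_map_inj: "inj_on (auslander_map S G) (G \<rightarrow>\<^sub>E carrier S)"
proof (rule inj_onI)
  fix u v assume u: "u \<in> G \<rightarrow>\<^sub>E carrier S" and v: "v \<in> G \<rightarrow>\<^sub>E carrier S"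
    and eq: "auslander_map S G u = auslander_map S G v"
  show "u = v"
  proof (rule PiE_ext[OF u v])
    fix g assume g: "g \<in> G"
    have "coord (u g) = coord (v g)"
    proof (rule poly_mapping_eqI)
      fix b
      let ?c = "\<lambda>g. Poly_Mapping.lookup (coord (u g)) b - Poly_Mapping.lookup (coord (v g)) b"
      have "?c g = 0"
      proof (rule characters_independent[of G monomials ev ?c])
        fix a assume a: "a \<in> monomials"
        define w where "w = of_coord (Poly_Mapping.single a 1)"
        have w: "w \<in> carrier S" "coord w = Poly_Mapping.single a 1"
          using a by (simp_all add: w_def of_coord_closed coord_of_coord)
        have lk: "Poly_Mapping.lookup (coord (auslander_map S G u w)) (b + a)
            = (\<Sum>g\<in>G. Poly_Mapping.lookup (coord (u g)) b * ev g a) * \<xi> powi beta b a"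
          if "u \<in> G \<rightarrow>\<^sub>E carrier S" for u
          using that w by (simp add: coord_auslander_map lookup_sum lookup_star_single sum_distrib_right)
        show "(\<Sum>g\<in>G. ?c g * ev g a) = 0"
          using lk[OF u] lk[OF v] eq by (simp add: left_diff_distrib sum_subtractf)
      next
        show "\<exists>a\<in>monomials. ev g a \<noteq> ev h a" if "g \<in> G" "h \<in> G" "g \<noteq> h" for g h
          using ev_inject that by blast
      qed (use g S.finite_G ev_add ev_0 in auto)
      then show "Poly_Mapping.lookup (coord (u g)) b = Poly_Mapping.lookup (coord (v g)) b" by simp
    qed
    then show "u g = v g" using coord_inject[OF PiE_mem[OF u g] PiE_mem[OF v g]] by simp
  qed
qed

section \<open>Invariants, and left division as an obstruction\<close>

lemma mem_fixed_ring:
  assumes "t \<in> monomials" "cls t = cls {#}"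
  shows "of_coord (Poly_Mapping.single t c) \<in> fixed_ring S G"
proof -
  have w: "of_coord (Poly_Mapping.single t c) \<in> carrier S" "coord (of_coord (Poly_Mapping.single t c)) = Poly_Mapping.single t c"
    using assms(1) by (simp_all add: of_coord_closed coord_of_coord)
  have "g (of_coord (Poly_Mapping.single t c)) = of_coord (Poly_Mapping.single t c)" if g: "g \<in> G" for g
  proof -
    have "coord (g (of_coord (Poly_Mapping.single t c))) = coord (of_coord (Poly_Mapping.single t c))"
      using g w ev_cong[OF g assms(1) _ assms(2)] ev_0[OF g] by (simp add: coord_conj)
    then show ?thesis using g w(1) by (simp add: coord_inject)
  qed
  then show ?thesis using w(1) by (simp add: fixed_ring_def)
qed

lemma fixed_ring_keys:
  assumes t: "t \<in> fixed_ring S G" and a: "a \<in> Poly_Mapping.keys (coord t)"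
  shows "cls a = cls {#}"
proof (rule cls_eqI)
  have tc: "t \<in> carrier S" using t by (simp add: fixed_ring_def)
  then have am: "a \<in> monomials" using coord_closed a by (auto simp: carrier_model)
  fix i assume i: "i \<in> {1..n}"
  then have g: "theta {#i#} \<in> G" by (auto simp: conj_group_eq)
  then have "theta {#i#} t = t" using t unfolding fixed_ring_def by blast
  then have "diag (chi {#i#}) (coord t) = coord t"
    using coord_theta[OF tc, of "{#i#}"] by simp
  then have "chi {#i#} a * Poly_Mapping.lookup (coord t) a = Poly_Mapping.lookup (coord t) a"
    by (metis lookup_diag)
  then show "chi {#i#} a = chi {#i#} {#}" using a by (simp add: in_keys_iff)
qed

text \<open>Left division by \<open>x\<^sub>i\<close> on the isotypic component of \<open>x\<^sub>i\<close>; it is defined when no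
  monomial of that component avoids \<open>x\<^sub>i\<close>.\<close>

definition divide_var :: "nat \<Rightarrow> (nat multiset \<Rightarrow>\<^sub>0 'k) \<Rightarrow> (nat multiset \<Rightarrow>\<^sub>0 'k)"
  where "divide_var i = lin_ext (\<lambda>a c. if cls a = cls {#i#}
    then Poly_Mapping.single (a - {#i#}) (c * \<xi> powi (- beta {#i#} (a - {#i#}))) else 0)"

lemma divide_var_simps:
  "divide_var i 0 = 0" "divide_var i (F + H) = divide_var i F + divide_var i H"
  "divide_var i (Poly_Mapping.single a c) = (if cls a = cls {#i#}
    then Poly_Mapping.single (a - {#i#}) (c * \<xi> powi (- beta {#i#} (a - {#i#}))) else 0)"
  unfolding divide_var_def
  by (auto simp: lin_ext_single distrib_right single_add intro!: lin_ext_add)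

text \<open>Multiplication by an invariant monomial preserves the class. Within the class of
  \<open>x_i\<close> every exponent contains \<open>i\<close>, so removing \<open>i\<close> commutes
  with adding \<open>t\<close>; biadditivity of \<open>beta\<close> matches the scalars.\<close>

lemma divide_var_star:
  assumes i: "\<And>a. a \<in> monomials \<Longrightarrow> cls a = cls {#i#} \<Longrightarrow> i \<in># a"
    and F: "F \<in> carrier model" and T: "\<And>t. t \<in> Poly_Mapping.keys T \<Longrightarrow> cls t = cls {#}"
  shows "divide_var i (F \<star> T) = divide_var i F \<star> T"
proof (induction F rule: poly_mapping_additive_induct)
  case (single a c)
  then have a: "a \<in> monomials" using F by (auto simp: carrier_model)
  show ?case
  proof (induction T rule: poly_mapping_additive_induct)
    case (single t d)
    then have t: "cls t = cls {#}" by (rule T)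
    have cls: "cls (a + t) = cls a" using cls_add[OF refl t, of a] by simp
    show ?case
    proof (cases "cls a = cls {#i#}")
      case True
      then have "i \<in># a" using i a by blast
      then obtain a' where a': "a = {#i#} + a'" by (metis add_mset_add_single add.commute multi_member_split)
      have sub: "a + t - {#i#} = a' + t" "a - {#i#} = a'" by (simp_all add: a')
      have "beta a t + - beta {#i#} (a' + t) = - beta {#i#} a' + beta a' t"
        unfolding a' beta_simps by simp
      then have "\<xi> powi beta a t * \<xi> powi (- beta {#i#} (a' + t)) = \<xi> powi (- beta {#i#} a') * \<xi> powi beta a' t"
        by (metis power_int_add xi_nonzero)
      then have "c * d * \<xi> powi beta a t * \<xi> powi (- beta {#i#} (a' + t))
          = c * \<xi> powi (- beta {#i#} a') * d * \<xi> powi beta a' t"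
        by (simp only: mult.assoc mult.left_commute[of _ d])
      then show ?thesis
        using True cls by (simp only: star_single divide_var_simps sub if_True simp_thms)
    qed (use cls in \<open>simp add: divide_var_simps\<close>)
  qed (simp_all add: star_add_right divide_var_simps)
qed (simp_all add: star_add_left divide_var_simps)

lemma divide_var_closed:
  assumes "F \<in> carrier model"
  shows "divide_var i F \<in> carrier model"
proof -
  have "Poly_Mapping.keys (divide_var i F) \<subseteq> (\<lambda>a. a - {#i#}) ` Poly_Mapping.keys F"
    unfolding divide_var_def lin_ext_def
    by (rule order_trans[OF keys_sum] UN_least)+ (auto split: if_splits)
  then show ?thesis
    using assms by (force simp: carrier_model monomials_def dest: in_diffD)
qed

lemma not_auslander_if_unavoidable:
  assumes i: "i \<in> {1..n}" and avoid: "\<And>a. a \<in> monomials \<Longrightarrow> cls a = cls {#i#} \<Longrightarrow> i \<in># a"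
  shows "\<not> satisfies_auslander S G"
proof
  assume "satisfies_auslander S G"
  then have surj: "auslander_map S G ` (G \<rightarrow>\<^sub>E carrier S) = carrier (End_ring S (fixed_ring S G))"
    by (simp add: S.satisfies_auslander_iff_bij bij_betw_def)
  define f where "f = (\<lambda>b\<in>carrier S. of_coord (divide_var i (coord b)))"
  have fc: "f b \<in> carrier S" "coord (f b) = divide_var i (coord b)" if "b \<in> carrier S" for b
    using that by (simp_all add: f_def of_coord_closed coord_of_coord divide_var_closed coord_closed)
  have "f \<in> carrier (End_ring S (fixed_ring S G))"
  proof -
    have "f (a \<oplus>\<^bsub>S\<^esub> b) = f a \<oplus>\<^bsub>S\<^esub> f b" if "a \<in> carrier S" "b \<in> carrier S" for a b
    proof -
      have "coord (f (a \<oplus>\<^bsub>S\<^esub> b)) = coord (f a \<oplus>\<^bsub>S\<^esub> f b)"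
        using that by (simp add: fc coord_add divide_var_simps)
      then show ?thesis using that by (subst (asm) coord_inject) (simp_all add: fc)
    qed
    moreover have "f (a \<otimes>\<^bsub>S\<^esub> t) = f a \<otimes>\<^bsub>S\<^esub> t" if "a \<in> carrier S" "t \<in> fixed_ring S G" for a t
    proof -
      have t: "t \<in> carrier S" using that(2) by (simp add: fixed_ring_def)
      have "divide_var i (coord a \<star> coord t) = divide_var i (coord a) \<star> coord t"
        using that t fixed_ring_keys by (intro divide_var_star avoid coord_closed) auto
      then have "coord (f (a \<otimes>\<^bsub>S\<^esub> t)) = coord (f a \<otimes>\<^bsub>S\<^esub> t)"
        using that t by (simp add: fc coord_mult)
      then show ?thesis using that t by (subst (asm) coord_inject) (simp_all add: fc)
    qed
    moreover have "f \<in> carrier S \<rightarrow>\<^sub>E carrier S" using fc by (auto simp: f_def)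
    ultimately show ?thesis by (simp add: End_ring_def)
  qed
  then have "f \<in> auslander_map S G ` (G \<rightarrow>\<^sub>E carrier S)"
    by (simp only: surj)
  then obtain u where u: "u \<in> G \<rightarrow>\<^sub>E carrier S" "f = auslander_map S G u"
    by (rule imageE)
  note x = coord_skew_var[OF i]
  \<comment> \<open>Left division sends \<open>x_i\<close> to \<open>1\<close>, whereas every
    element of the image of the Auslander map sends \<open>x_i\<close> into \<open>S x_i\<close>,
    where constant terms vanish.\<close>
  have "Poly_Mapping.lookup (coord (f (skew_var n p i))) {#} = 1"
    by (simp add: fc x divide_var_simps)
  moreover have "Poly_Mapping.lookup (coord (u g) \<star> Poly_Mapping.single {#i#} c) {#} = 0" for g c
    using keys_star[of "coord (u g)" "Poly_Mapping.single {#i#} c"]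
    by (auto simp: in_keys_iff split: if_splits)
  then have "Poly_Mapping.lookup (coord (f (skew_var n p i))) {#} = 0"
    unfolding u(2) using u(1) by (simp add: x coord_auslander_map lookup_sum)
  ultimately show False by simp
qed

section \<open>Surjectivity when every variable can be avoided\<close>

lemma cls_repeat_l: "cls (repeat_mset l a) = cls {#}"
  by (intro cls_eqI) (simp add: chi_def xi_powi_eq_1_iff)

lemma keys_star_single:
  assumes "c \<noteq> 0"
  shows "Poly_Mapping.keys (F \<star> Poly_Mapping.single t c) = (\<lambda>e. e + t) ` Poly_Mapping.keys F"
proof
  show "Poly_Mapping.keys (F \<star> Poly_Mapping.single t c) \<subseteq> (\<lambda>e. e + t) ` Poly_Mapping.keys F"
    using keys_star[of F "Poly_Mapping.single t c"] by (auto split: if_splits)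
  show "(\<lambda>e. e + t) ` Poly_Mapping.keys F \<subseteq> Poly_Mapping.keys (F \<star> Poly_Mapping.single t c)"
    using assms by (auto simp: in_keys_iff lookup_star_single)
qed

text \<open>Divisibility by a monomial can be tested on single terms; the power of
  \<open>\<xi>\<close> in the quotient compensates the twist.\<close>

lemma right_divisible:
  assumes "F \<in> carrier model" "\<And>e. e \<in> Poly_Mapping.keys F \<Longrightarrow> a \<subseteq># e"
  shows "\<exists>R\<in>carrier model. F = R \<star> Poly_Mapping.single a 1"
proof (induction F rule: poly_mapping_additive_induct)
  case zero
  show ?case by (intro bexI[of _ 0]) simp_all
next
  case (single e c)
  then obtain e' where e': "e = e' + a"
    using assms(2) by (metis subset_mset.add_diff_inverse add.commute)
  then have "e' \<in> monomials" using single assms(1) by (auto simp: carrier_model)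
  then show ?case
    by (intro bexI[of _ "Poly_Mapping.single e' (c * \<xi> powi (- beta e' a))"])
      (simp_all add: e' power_int_minus mult.assoc)
next
  case (add F H)
  then show ?case by (auto simp flip: star_add_left)
qed

text \<open>Classes are compatible with sums, so each occurrence of \<open>i\<close> can be replaced
  by an equivalent exponent without \<open>i\<close>, while the other letters stay.\<close>

lemma avoid_var:
  assumes "\<And>i. i \<in> {1..n} \<Longrightarrow> \<exists>b\<in>monomials. cls b = cls {#i#} \<and> i \<notin># b"
    and "i \<in> {1..n}" "a \<in> monomials"
  shows "\<exists>b\<in>monomials. cls b = cls a \<and> i \<notin># b"
  using \<open>a \<in> monomials\<close>
proof (induction a)
  case (add s a)
  then obtain b where b: "b \<in> monomials" "cls b = cls a" "i \<notin># b" by auto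
  have "\<exists>c\<in>monomials. cls c = cls {#s#} \<and> i \<notin># c"
    using assms(1)[OF assms(2)] add.prems by (cases "s = i") (auto intro: bexI[of _ "{#s#}"])
  then obtain c where c: "c \<in> monomials" "cls c = cls {#s#}" "i \<notin># c" by blast
  then show ?case
    using b cls_add[OF c(2) b(2)] by (intro bexI[of _ "c + b"]) auto
qed auto

text \<open>If \<open>cls a = cls b\<close>, then \<open>a + ((l - 1) a + b) = b + l a\<close>, where \<open>(l - 1) a + b\<close> and \<open>l a\<close> are
  exponents of invariant monomials, so the images of \<open>x\<^sup>a\<close> and \<open>x\<^sup>b\<close> determine each other. Taking for \<open>b\<close>
  an exponent without \<open>i\<close> shows that the image of \<open>x\<^sup>a\<close> is divisible by the \<open>x\<^sub>i\<close>-part of \<open>x\<^sup>a\<close>.\<close>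

lemma endomorphism_multiplier:
  assumes avoid: "\<And>i. i \<in> {1..n} \<Longrightarrow> \<exists>b\<in>monomials. cls b = cls {#i#} \<and> i \<notin># b"
    and closed: "\<And>F. F \<in> carrier model \<Longrightarrow> \<phi> F \<in> carrier model"
    and star: "\<And>F t c. \<lbrakk>F \<in> carrier model; t \<in> monomials; cls t = cls {#}\<rbrakk> \<Longrightarrow>
      \<phi> (F \<star> Poly_Mapping.single t c) = \<phi> F \<star> Poly_Mapping.single t c"
  obtains r where "\<And>a. a \<in> monomials \<Longrightarrow> r a \<in> carrier model"
    "\<And>a c. a \<in> monomials \<Longrightarrow> \<phi> (Poly_Mapping.single a c) = r a \<star> Poly_Mapping.single a c"
    "\<And>a b. \<lbrakk>a \<in> monomials; b \<in> monomials; cls a = cls b\<rbrakk> \<Longrightarrow> r a = r b"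
proof -
  let ?x = "\<lambda>a c. Poly_Mapping.single a c :: nat multiset \<Rightarrow>\<^sub>0 'k"
  have shift: "\<phi> (?x (a + t) c) = \<phi> (?x a 1) \<star> ?x t (c * \<xi> powi (- beta a t))"
    if "a \<in> monomials" "t \<in> monomials" "cls t = cls {#}" for a t c
  proof -
    have "?x (a + t) c = ?x a 1 \<star> ?x t (c * \<xi> powi (- beta a t))"
      by (simp add: power_int_minus mult.assoc)
    then show ?thesis using star[OF _ that(2,3), of "?x a 1"] that(1) by simp
  qed
  have meet: "\<exists>t\<in>monomials. cls t = cls {#} \<and> a + t = b + repeat_mset l a \<and> count t i + count a i = count b i + l * count a i"
    if ab: "a \<in> monomials" "b \<in> monomials" "cls a = cls b" for a b i
  proof (intro bexI conjI)
    let ?t = "repeat_mset (l - 1) a + b"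
    have l: "repeat_mset (l - 1) a + a = repeat_mset l a"
      using l_gt_1 by (intro multiset_eqI) (cases l, auto)
    have "cls ?t = cls (repeat_mset (l - 1) a + a)"
      using ab(3) by (intro cls_add) auto
    then show "cls ?t = cls {#}" unfolding l by (simp add: cls_repeat_l)
    show eq: "a + ?t = b + repeat_mset l a"
      using l by (simp add: ac_simps flip: l)
    show "count ?t i + count a i = count b i + l * count a i"
      using arg_cong[OF eq, of "\<lambda>m. count m i"] by simp
    show "?t \<in> monomials" using ab by (simp add: repeat_mset_monomials)
  qed
  have "\<exists>R\<in>carrier model. \<phi> (?x a 1) = R \<star> ?x a 1" if a: "a \<in> monomials" for a
  proof (rule right_divisible)
    show F: "\<phi> (?x a 1) \<in> carrier model" using closed a by simp
    fix e assume e: "e \<in> Poly_Mapping.keys (\<phi> (?x a 1))"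
    show "a \<subseteq># e"
    proof (rule mset_subset_eqI)
      fix i
      show "count a i \<le> count e i"
      proof (cases "i \<in># a")
        case True
        then have "i \<in> {1..n}" using a by (auto simp: monomials_def)
        then obtain b where b: "b \<in> monomials" "cls b = cls a" "i \<notin># b"
          using avoid_var[OF avoid _ a] by blast
        obtain t where t: "t \<in> monomials" "cls t = cls {#}" "a + t = b + repeat_mset l a"
          "count t i + count a i = count b i + l * count a i"
          using meet[OF a b(1) b(2)[symmetric]] by blast
        \<comment> \<open>Computed through \<open>b\<close>, the image of the common monomial has
          only exponents of the form \<open>e' + l a\<close>. Since \<open>b\<close> omits
          \<open>i\<close>, \<open>t\<close> contains it \<open>(l - 1) * count a i\<close> times,
          which leaves \<open>count e i = count e' i + count a i\<close>.\<close>
        have "e + t \<in> Poly_Mapping.keys (\<phi> (?x (a + t) 1))"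
          using e by (simp add: shift[OF a t(1,2)] keys_star_single)
        then have "e + t \<in> Poly_Mapping.keys (\<phi> (?x (b + repeat_mset l a) 1))"
          by (simp only: t(3))
        then obtain e' where "e + t = e' + repeat_mset l a"
          using shift[OF b(1) repeat_mset_monomials[OF a] cls_repeat_l] by (auto simp: keys_star_single)
        then have "count e i + count t i = count e' i + l * count a i"
          by (metis count_repeat_mset count_union)
        then show ?thesis using t(4) b(3) by (simp add: not_in_iff)
      qed (simp add: not_in_iff)
    qed
  qed
  then obtain r where r: "\<And>a. a \<in> monomials \<Longrightarrow> r a \<in> carrier model"
    "\<And>a. a \<in> monomials \<Longrightarrow> \<phi> (?x a 1) = r a \<star> ?x a 1"
    by metis
  have rt: "\<phi> (?x (a + t) c) = r a \<star> ?x (a + t) c"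
    if "a \<in> monomials" "t \<in> monomials" "cls t = cls {#}" for a t c
    by (simp add: shift[OF that] r(2)[OF that(1)] star_assoc power_int_minus mult.assoc)
  show thesis
  proof (rule that[OF r(1)])
    show "\<phi> (?x a c) = r a \<star> ?x a c" if "a \<in> monomials" for a c
      using rt[OF that, of "{#}" c] by simp
    fix a b assume ab: "a \<in> monomials" "b \<in> monomials" "cls a = cls b"
    obtain t where t: "t \<in> monomials" "cls t = cls {#}" "a + t = b + repeat_mset l a"
      using meet[OF ab] by blast
    \<comment> \<open>Both multipliers compute the image of the same monomial, and monomials cancel
      on the right.\<close>
    have "r a \<star> ?x (a + t) 1 = r b \<star> ?x (a + t) 1"
      using rt[OF ab(1) t(1,2), of 1] rt[OF ab(2) repeat_mset_monomials[OF ab(1)] cls_repeat_l, of 1]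
      by (simp only: t(3))
    then show "r a = r b" by (rule star_single_cancel) simp
  qed
qed

text \<open>Fourier inversion: let \<open>u g\<close> be the sum of
  \<open>r b / (card G * ev g b)\<close> over one \<open>b\<close> per class. By orthogonality only
  the class of \<open>a\<close> contributes to the value at \<open>x^a\<close>, which is therefore
  \<open>r a \<star> x^a\<close>.\<close>

lemma auslander_map_preimage:
  assumes r: "\<And>a. a \<in> monomials \<Longrightarrow> r a \<in> carrier model"
    and \<phi>: "\<And>a c. a \<in> monomials \<Longrightarrow> \<phi> (Poly_Mapping.single a c) = r a \<star> Poly_Mapping.single a c"
    and cong: "\<And>a b. \<lbrakk>a \<in> monomials; b \<in> monomials; cls a = cls b\<rbrakk> \<Longrightarrow> r a = r b"
    and \<phi>_add: "\<And>F H. \<lbrakk>F \<in> carrier model; H \<in> carrier model\<rbrakk> \<Longrightarrow> \<phi> (F + H) = \<phi> F + \<phi> H"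
  obtains u where "u \<in> G \<rightarrow>\<^sub>E carrier S"
    "\<And>F. F \<in> carrier model \<Longrightarrow> (\<Sum>g\<in>G. coord (u g) \<star> diag (ev g) F) = \<phi> F"
proof -
  let ?x = "\<lambda>a c. Poly_Mapping.single a c :: nat multiset \<Rightarrow>\<^sub>0 'k"
  define rep where "rep a = (SOME b. b \<in> monomials \<and> cls b = cls a)" for a
  have rep: "rep a \<in> monomials" "cls (rep a) = cls a" if "a \<in> monomials" for a
    using someI[of "\<lambda>b. b \<in> monomials \<and> cls b = cls a" a] that by (auto simp: rep_def)
  define C where "C = rep ` monomials"
  have C: "b \<in> monomials" if "b \<in> C" for b
    using that rep by (auto simp: C_def)
  have C_iff: "cls a = cls b \<longleftrightarrow> b = rep a" if "a \<in> monomials" "b \<in> C" for a b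
  proof
    assume "cls a = cls b"
    then have "rep a = rep b" by (simp add: rep_def)
    moreover obtain c where "c \<in> monomials" "b = rep c" using \<open>b \<in> C\<close> by (auto simp: C_def)
    then have "rep b = b" using rep(2)[of c] by (simp add: rep_def)
    ultimately show "b = rep a" by simp
  qed (use rep that in simp)
  have finC: "finite C"
    unfolding C_def by (rule finite_image_factor[OF finite_cls]) (simp add: rep_def)
  \<comment> \<open>Characteristic \<open>0\<close> makes the group order invertible.\<close>
  have card: "(of_nat (card G) :: 'k) \<noteq> 0"
    using S.finite_G S.id_mem by auto
  let ?k = "\<lambda>g b. 1 / (of_nat (card G) * ev g b) :: 'k"
  define u where "u = (\<lambda>g\<in>G. of_coord (\<Sum>b\<in>C. r b \<star> ?x {#} (?k g b)))"
  have closed: "(\<Sum>b\<in>C. r b \<star> ?x {#} (?k g b)) \<in> carrier model" for g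
    using r C by (intro carrier_model_sum) auto
  show thesis
  proof
    show "u \<in> G \<rightarrow>\<^sub>E carrier S"
      using closed by (auto simp: u_def of_coord_closed)
    fix F assume "F \<in> carrier model"
    have \<phi>_0: "\<phi> 0 = 0" using \<phi>_add[of 0 0] by simp
    have single: "(\<Sum>g\<in>G. coord (u g) \<star> diag (ev g) (?x a c)) = \<phi> (?x a c)" if a: "a \<in> monomials" for a c
    proof -
      have scalar: "(\<Sum>g\<in>G. ?k g b * ev g a * c) = (if cls a = cls b then c else 0)" if b: "b \<in> C" for b
      proof -
        have "(\<Sum>g\<in>G. ?k g b * ev g a * c) = (\<Sum>g\<in>G. ev g a / ev g b) * c / of_nat (card G)"
          unfolding sum_distrib_right sum_divide_distrib by (simp add: divide_inverse ac_simps)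
        then show ?thesis using sum_ev[OF a C[OF b]] card by simp
      qed
      have "(\<Sum>g\<in>G. coord (u g) \<star> diag (ev g) (?x a c)) = (\<Sum>g\<in>G. \<Sum>b\<in>C. r b \<star> ?x a (?k g b * ev g a * c))"
        using closed by (intro sum.cong) (simp_all add: u_def coord_of_coord star_sum_left star_assoc mult.assoc)
      also have "\<dots> = (\<Sum>b\<in>C. r b \<star> (\<Sum>g\<in>G. ?x a (?k g b * ev g a * c)))"
        by (subst sum.swap) (simp add: star_sum_right)
      also have "\<dots> = (\<Sum>b\<in>C. r b \<star> ?x a (\<Sum>g\<in>G. ?k g b * ev g a * c))"
        by (simp add: single_sum)
      also have "\<dots> = (\<Sum>b\<in>C. if b = rep a then r b \<star> ?x a c else 0)"
        using C_iff[OF a] by (intro sum.cong refl) (simp only: scalar, simp)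
      also have "\<dots> = r (rep a) \<star> ?x a c"
        using finC a by (simp add: C_def)
      also have "\<dots> = \<phi> (?x a c)"
        using cong[OF rep(1)[OF a] a rep(2)[OF a]] \<phi>[OF a] by simp
      finally show ?thesis .
    qed
    \<comment> \<open>Membership in the model is carried through the induction because
      \<open>\<phi>\<close> is additive only there.\<close>
    have "F \<in> carrier model \<and> (\<Sum>g\<in>G. coord (u g) \<star> diag (ev g) F) = \<phi> F"
    proof (induction F rule: poly_mapping_additive_induct)
      case (single a c)
      then have "a \<in> monomials" using \<open>F \<in> carrier model\<close> by (auto simp: carrier_model)
      then show ?case using \<open>\<And>a c. a \<in> monomials \<Longrightarrow> (\<Sum>g\<in>G. coord (u g) \<star> diag (ev g) (?x a c)) = \<phi> (?x a c)\<close>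
        by simp
    qed (simp_all add: \<phi>_0 \<phi>_add star_add_right sum.distrib)
    then show "(\<Sum>g\<in>G. coord (u g) \<star> diag (ev g) F) = \<phi> F" by simp
  qed
qed

text \<open>An endomorphism is transported to coordinates, where it acts by a multiplier on each
  class and so comes from the skew group ring.\<close>

lemma auslander_if_avoidable:
  assumes avoid: "\<And>i. i \<in> {1..n} \<Longrightarrow> \<exists>b\<in>monomials. cls b = cls {#i#} \<and> i \<notin># b"
  shows "satisfies_auslander S G"
proof -
  have "f \<in> auslander_map S G ` (G \<rightarrow>\<^sub>E carrier S)"
    if f: "f \<in> carrier (End_ring S (fixed_ring S G))" for f
  proof -
    have f_ext: "f \<in> carrier S \<rightarrow>\<^sub>E carrier S"
      and f_add: "\<And>a b. a \<in> carrier S \<Longrightarrow> b \<in> carrier S \<Longrightarrow> f (a \<oplus>\<^bsub>S\<^esub> b) = f a \<oplus>\<^bsub>S\<^esub> f b"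
      and f_lin: "\<And>a t. a \<in> carrier S \<Longrightarrow> t \<in> fixed_ring S G \<Longrightarrow> f (a \<otimes>\<^bsub>S\<^esub> t) = f a \<otimes>\<^bsub>S\<^esub> t"
      using f by (simp_all add: End_ring_def)
    have fc: "f a \<in> carrier S" if "a \<in> carrier S" for a using f_ext that by auto
    define \<phi> where "\<phi> F = coord (f (of_coord F))" for F
    have \<phi>_closed: "\<phi> F \<in> carrier model" if "F \<in> carrier model" for F
      using that by (simp add: \<phi>_def coord_closed fc of_coord_closed)
    have \<phi>_add: "\<phi> (F + H) = \<phi> F + \<phi> H" if FH: "F \<in> carrier model" "H \<in> carrier model" for F H
    proof -
      have "of_coord (F + H) = of_coord F \<oplus>\<^bsub>S\<^esub> of_coord H"
        using FH by (subst coord_inject[symmetric]) (simp_all add: of_coord_closed coord_of_coord coord_add)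
      then show ?thesis using FH by (simp add: \<phi>_def f_add fc of_coord_closed coord_add)
    qed
    have \<phi>_star: "\<phi> (F \<star> Poly_Mapping.single t c) = \<phi> F \<star> Poly_Mapping.single t c"
      if F: "F \<in> carrier model" and t: "t \<in> monomials" "cls t = cls {#}" for F t c
    proof -
      have "of_coord (F \<star> Poly_Mapping.single t c) = of_coord F \<otimes>\<^bsub>S\<^esub> of_coord (Poly_Mapping.single t c)"
        using F t(1) by (subst coord_inject[symmetric]) (simp_all add: of_coord_closed coord_of_coord coord_mult)
      then show ?thesis using F t
        by (simp add: \<phi>_def f_lin mem_fixed_ring fc of_coord_closed coord_mult coord_of_coord)
    qed
    obtain r where r: "\<And>a. a \<in> monomials \<Longrightarrow> r a \<in> carrier model"
      "\<And>a c. a \<in> monomials \<Longrightarrow> \<phi> (Poly_Mapping.single a c) = r a \<star> Poly_Mapping.single a c"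
      "\<And>a b. \<lbrakk>a \<in> monomials; b \<in> monomials; cls a = cls b\<rbrakk> \<Longrightarrow> r a = r b"
      using endomorphism_multiplier[of \<phi>, OF avoid \<phi>_closed \<phi>_star] by blast
    obtain u where u: "u \<in> G \<rightarrow>\<^sub>E carrier S"
      "\<And>F. F \<in> carrier model \<Longrightarrow> (\<Sum>g\<in>G. coord (u g) \<star> diag (ev g) F) = \<phi> F"
      using auslander_map_preimage[of r \<phi>, OF r \<phi>_add] by blast
    have "f = auslander_map S G u"
    proof
      fix b
      show "f b = auslander_map S G u b"
      proof (cases "b \<in> carrier S")
        case True
        have "auslander_map S G u b \<in> carrier S"
          using S.auslander_map_in_End[OF u(1)] True by (auto simp: End_ring_def)
        moreover have "coord (f b) = coord (auslander_map S G u b)"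
          using True by (simp add: coord_auslander_map[OF u(1)] u(2) coord_closed \<phi>_def of_coord_coord)
        ultimately show ?thesis using True fc by (simp add: coord_inject)
      next
        case False
        then show ?thesis using f_ext by (auto simp: auslander_map_def)
      qed
    qed
    then show ?thesis using u(1) by blast
  qed
  then show ?thesis
    using auslander_map_inj S.auslander_map_in_End
    by (auto simp: S.satisfies_auslander_iff_bij bij_betw_def)
qed

end

section \<open>Dimensions two, three and four\<close>

context skew_poly_setting
begin

section \<open>The criterion in terms of the kernel of \<open>B\<close> modulo
  \<open>l\<close>\<close>

lemma omega_eq_sum:
  assumes "b \<in> monomials"
  shows "omega {#s#} b = (\<Sum>j\<in>{1..n}. B s j * int (count b j))"
  using assms
proof (induction b)
  case (add k b)
  have "(\<Sum>j\<in>{1..n}. B s j * int (count (add_mset k b) j))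
      = (\<Sum>j\<in>{1..n}. (if j = k then B s j else 0) + B s j * int (count b j))"
    by (intro sum.cong) (auto simp: algebra_simps)
  also have "\<dots> = B s k + (\<Sum>j\<in>{1..n}. B s j * int (count b j))"
    using add.prems by (simp add: sum.distrib)
  finally show ?case
    using add by (simp add: omega_add_mset(2)[of _ k b]) (simp add: omega_def)
qed simp

text \<open>An exponent \<open>b\<close> without \<open>i\<close> in the class of \<open>x_i\<close>
  corresponds to the kernel vector \<open>e_i - b\<close>, whose \<open>i\<close>-th entry is
  \<open>1\<close>.\<close>

lemma auslander_iff:
  "satisfies_auslander S G \<longleftrightarrow>
    (\<forall>i\<in>{1..n}. \<exists>t. t i = 1 \<and> (\<forall>s\<in>{1..n}. int l dvd (\<Sum>j\<in>{1..n}. B s j * t j)))"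
proof -
  have "satisfies_auslander S G \<longleftrightarrow> (\<forall>i\<in>{1..n}. \<exists>b\<in>monomials. cls b = cls {#i#} \<and> i \<notin># b)"
    using auslander_if_avoidable not_auslander_if_unavoidable by blast
  moreover have "(\<exists>b\<in>monomials. cls b = cls {#i#} \<and> i \<notin># b) \<longleftrightarrow>
      (\<exists>t. t i = 1 \<and> (\<forall>s\<in>{1..n}. int l dvd (\<Sum>j\<in>{1..n}. B s j * t j)))"
    (is "?avoid \<longleftrightarrow> ?kernel") if i: "i \<in> {1..n}" for i
  proof
    assume ?avoid
    then obtain b where b: "b \<in> monomials" "cls b = cls {#i#}" "i \<notin># b" by blast
    define t where "t j = (if j = i then 1 else - int (count b j))" for j
    have "int l dvd (\<Sum>j\<in>{1..n}. B s j * t j)" if s: "s \<in> {1..n}" for s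
    proof -
      have "(\<Sum>j\<in>{1..n}. B s j * t j) = (\<Sum>j\<in>{1..n}. (if j = i then B s j else 0) - B s j * int (count b j))"
        using b(3) by (intro sum.cong) (auto simp: t_def not_in_iff)
      also have "\<dots> = omega {#s#} {#i#} - omega {#s#} b"
        using i by (simp add: sum_subtractf omega_eq_sum[OF b(1)]) (simp add: omega_def)
      finally show ?thesis
        using cls_eqD[OF b(2) s] by (simp add: mod_eq_dvd_iff dvd_diff_commute)
    qed
    then show ?kernel by (intro exI[of _ t]) (simp add: t_def)
  next
    assume ?kernel
    then obtain t where t: "t i = 1" "\<And>s. s \<in> {1..n} \<Longrightarrow> int l dvd (\<Sum>j\<in>{1..n}. B s j * t j)" by blast
    \<comment> \<open>Exponents must be nonnegative, so the entries of \<open>e_i - t\<close> are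
      reduced modulo \<open>l\<close>; this leaves the class unchanged, and the entry at
      \<open>i\<close> is zero.\<close>
    define b where "b = (\<Sum>j\<in>{1..n} - {i}. replicate_mset (nat (- t j mod int l)) j)"
    have count: "count b j = (if j \<in> {1..n} - {i} then nat (- t j mod int l) else 0)" for j
      by (simp add: b_def count_sum if_distrib sum.delta' cong: if_cong)
    have b: "b \<in> monomials"
      using count by (auto simp: monomials_def simp flip: count_greater_zero_iff split: if_splits)
    have "omega {#s#} b mod int l = omega {#s#} {#i#} mod int l" if s: "s \<in> {1..n}" for s
    proof -
      let ?k = "\<lambda>j. if j = i then 0 else - t j div int l"
      have "omega {#s#} b = (\<Sum>j\<in>{1..n}. (if j = i then B s j else 0) - B s j * t j - int l * (B s j * ?k j))"
        unfolding omega_eq_sum[OF b]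
      proof (intro sum.cong refl)
        fix j assume j: "j \<in> {1..n}"
        have "- t j mod int l \<ge> 0" using l_gt_1 by simp
        then have "int (count b j) = (if j = i then 0 else - t j - int l * (- t j div int l))"
          using j by (simp only: count minus_mult_div_eq_mod) simp
        then show "B s j * int (count b j) = (if j = i then B s j else 0) - B s j * t j - int l * (B s j * ?k j)"
          using t(1) by (simp add: algebra_simps)
      qed
      also have "\<dots> = omega {#s#} {#i#} - (\<Sum>j\<in>{1..n}. B s j * t j) - int l * (\<Sum>j\<in>{1..n}. B s j * ?k j)"
        using i by (simp add: sum_subtractf sum_distrib_left) (simp add: omega_def)
      finally have "omega {#s#} b - omega {#s#} {#i#}
          = - (\<Sum>j\<in>{1..n}. B s j * t j) - int l * (\<Sum>j\<in>{1..n}. B s j * ?k j)" by simp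
      moreover have "int l dvd - (\<Sum>j\<in>{1..n}. B s j * t j) - int l * (\<Sum>j\<in>{1..n}. B s j * ?k j)"
        using t(2)[OF s] by simp
      ultimately show ?thesis by (simp only: mod_eq_dvd_iff)
    qed
    then have "cls b = cls {#i#}"
      unfolding cls_def by (intro restrict_ext) simp
    moreover have "i \<notin># b" by (simp add: not_in_iff count)
    ultimately show ?avoid using b by blast
  qed
  ultimately show ?thesis by simp
qed

text \<open>If \<open>q > 1\<close> divided \<open>l\<close> and all entries of \<open>B\<close>,
  then \<open>\<xi> ^ q\<close> would be a primitive root of unity of order \<open>l / q\<close>
  with every \<open>p i j\<close> among its powers, contrary to the minimality of
  \<open>l\<close>.\<close>

lemma no_common_divisor:
  assumes "d dvd int l" "\<And>i j. \<lbrakk>i \<in> {1..n}; j \<in> {1..n}\<rbrakk> \<Longrightarrow> d dvd B i j"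
  shows "\<bar>d\<bar> = 1"
proof (rule ccontr)
  assume d1: "\<bar>d\<bar> \<noteq> 1"
  define q where "q = nat \<bar>d\<bar>"
  have "d \<noteq> 0" using assms(1) l_gt_1 by auto
  then have q: "q > 1" "q dvd l" using d1 assms(1) by (auto simp: q_def nat_dvd_iff)
  have qB: "int q dvd B i j" if "i \<in> {1..n}" "j \<in> {1..n}" for i j
    using assms(2)[OF that] by (simp add: q_def)
  obtain m where m: "l = q * m" using q(2) by auto
  then have "m > 0" using l_gt_1 by (cases m) auto
  have xi: "\<xi> ^ l = 1" "\<And>d. 0 < d \<Longrightarrow> d < l \<Longrightarrow> \<xi> ^ d \<noteq> 1"
    using \<xi>_primitive by (auto simp: primitive_root_of_1_def)
  have "primitive_root_of_1 m (\<xi> ^ q)"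
    unfolding primitive_root_of_1_def
  proof (intro conjI allI impI)
    show "m > 0" by fact
    show "(\<xi> ^ q) ^ m = 1" using xi(1) by (simp add: m flip: power_mult)
    show "(\<xi> ^ q) ^ d \<noteq> 1" if "0 < d \<and> d < m" for d
      using xi(2)[of "q * d"] that q(1) by (simp add: m flip: power_mult)
  qed
  moreover have "\<exists>c::int. p i j = (\<xi> ^ q) powi c" if ij: "i \<in> {1..n}" "j \<in> {1..n}" for i j
  proof -
    obtain c where "B i j = int q * c" using qB[OF ij] by auto
    then show ?thesis using p_eq[OF ij] by (intro exI[of _ c]) (simp add: power_int_mult)
  qed
  ultimately have "l \<le> m" by (intro l_minimal) auto
  then show False using m q(1) \<open>m > 0\<close> by simp
qed

text \<open>For a kernel vector with first entry \<open>1\<close>, the second row says that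
  \<open>l\<close> divides \<open>B 2 1\<close>, hence all of \<open>B\<close>; this is impossible
  for \<open>l > 1\<close>.\<close>

lemma not_auslander_2:
  assumes "n = 2"
  shows "\<not> satisfies_auslander S G"
proof
  have N: "{1..n} = {1, 2}" using assms by auto
  have mem: "1 \<in> {1..n}" "2 \<in> {1..n}" unfolding N by auto
  note B = B_diag[OF mem(1)] B_diag[OF mem(2)] B_skew[OF mem]
  assume "satisfies_auslander S G"
  then obtain t where "t 1 = 1" "\<forall>s\<in>{1..n}. int l dvd (\<Sum>j\<in>{1..n}. B s j * t j)"
    unfolding auslander_iff using mem(1) by blast
  from this(1) bspec[OF this(2) mem(2)] have l: "int l dvd B 1 2"
    unfolding N using B by simp
  have "int l dvd B i j" if "i \<in> {1..n}" "j \<in> {1..n}" for i j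
    using that l B unfolding N by auto
  then have "\<bar>int l\<bar> = 1" by (intro no_common_divisor) auto
  then show False using l_gt_1 by simp
qed

text \<open>Given a kernel vector, rows \<open>i\<close> and \<open>j\<close> show that a common
  divisor of \<open>B i j\<close> and \<open>l\<close> divides the other entries too, so it is a
  unit.\<close>

lemma kernel_3_iff:
  assumes N: "{1..n} = {i, j, k}" and dist: "distinct [i, j, k]"
  shows "(\<exists>t. t k = 1 \<and> (\<forall>s\<in>{1..n}. int l dvd (\<Sum>j\<in>{1..n}. B s j * t j))) \<longleftrightarrow> gcd (B i j) (int l) = 1"
    (is "?kernel \<longleftrightarrow> _")
proof
  have mem: "i \<in> {1..n}" "j \<in> {1..n}" "k \<in> {1..n}" unfolding N by auto
  note [simp] = B_diag[OF mem(1)] B_diag[OF mem(2)] B_diag[OF mem(3)]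
    B_skew[OF mem(1,2)] B_skew[OF mem(1,3)] B_skew[OF mem(2,3)]
  have sum: "(\<Sum>j\<in>{1..n}. B s j * t j) = B s i * t i + B s j * t j + B s k * t k" for s and t :: "nat \<Rightarrow> int"
    unfolding N using dist by simp
  {
    assume ?kernel
    then obtain t where "t k = 1" "\<And>s. s \<in> {1..n} \<Longrightarrow> int l dvd B s i * t i + B s j * t j + B s k * t k"
      unfolding sum by blast
    from this(1) this(2)[OF mem(1)] this(2)[OF mem(2)]
    have "int l dvd B i j * t j + B i k" "int l dvd - (B i j * t i) + B j k" by simp_all
    moreover let ?g = "gcd (B i j) (int l)"
    have "?g dvd int l" "?g dvd B i j * t j" "?g dvd - (B i j * t i)" by auto
    ultimately have "?g dvd B i k" "?g dvd B j k" by (metis dvd_add_right_iff dvd_trans)+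
    then have "\<bar>?g\<bar> = 1"
      by (intro no_common_divisor) (unfold N, auto)
    then show "?g = 1" by simp
  }
  assume "gcd (B i j) (int l) = 1"
  then obtain x y where xy: "x * B i j + y * int l = 1" using bezout_int by metis
  \<comment> \<open>The kernel vector \<open>(B j k, - B i k, B i j)\<close>, scaled by the inverse
    \<open>x\<close> of \<open>B i j\<close> modulo \<open>l\<close>, with its last entry replaced
    by \<open>1\<close>. Row \<open>k\<close> vanishes exactly, the other two modulo
    \<open>l\<close>.\<close>
  define t where "t = (\<lambda>_. 0)(k := 1, i := x * B j k, j := - (x * B i k))"
  have t: "t i = x * B j k" "t j = - (x * B i k)" "t k = 1" using dist by (auto simp: t_def)
  have "B i k = int l * (y * B i k) + x * B i j * B i k" "B j k = int l * (y * B j k) + x * B i j * B j k"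
    using arg_cong[OF xy, of "\<lambda>z. z * B i k"] arg_cong[OF xy, of "\<lambda>z. z * B j k"]
    by (simp_all add: algebra_simps)
  then have "B i j * t j + B i k = int l * (y * B i k)" "B j i * t i + B j k = int l * (y * B j k)"
    by (simp_all add: t algebra_simps)
  then have "\<forall>s\<in>{i, j, k}. int l dvd B s i * t i + B s j * t j + B s k * t k"
    using t by simp
  then have "\<forall>s\<in>{1..n}. int l dvd (\<Sum>j\<in>{1..n}. B s j * t j)"
    by (simp only: sum flip: N)
  with t(3) show ?kernel by (intro exI[of _ t] conjI)
qed

lemma auslander_3_iff:
  assumes "n = 3"
  shows "satisfies_auslander S G \<longleftrightarrow> (\<forall>i\<in>{1..3}. \<forall>j\<in>{1..3}. i \<noteq> j \<longrightarrow> gcd (B i j) (int l) = 1)"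
proof -
  have N: "{1..n} = {1, 2, 3}" and N3: "{1..3} = {1, 2, 3::nat}" using assms by auto
  have N': "{1..n} = {2, 3, 1}" "{1..n} = {1, 3, 2}" using N by auto
  have "satisfies_auslander S G \<longleftrightarrow>
      gcd (B 1 2) (int l) = 1 \<and> gcd (B 1 3) (int l) = 1 \<and> gcd (B 2 3) (int l) = 1"
    unfolding auslander_iff using kernel_3_iff[OF N] kernel_3_iff[OF N'(1)] kernel_3_iff[OF N'(2)]
    by (subst N) auto
  moreover have "B 2 1 = - B 1 2" "B 3 1 = - B 1 3" "B 3 2 = - B 2 3"
    by (rule B_skew; simp add: assms)+
  ultimately show ?thesis unfolding N3 by auto
qed

lemma bezout_int_4:
  fixes a b c d :: int
  obtains x y z w where "x * a + y * b + z * c + w * d = gcd a (gcd b (gcd c d))"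
proof -
  obtain u z w where 1: "z * c + w * d = gcd c d" using bezout_int by metis
  obtain y v where 2: "y * b + v * gcd c d = gcd b (gcd c d)" using bezout_int by metis
  obtain x q where 3: "x * a + q * gcd b (gcd c d) = gcd a (gcd b (gcd c d))" using bezout_int by metis
  have "x * a + q * y * b + q * v * z * c + q * v * w * d = x * a + q * (y * b + v * (z * c + w * d))"
    by (simp add: algebra_simps)
  then show thesis
    by (intro that) (simp only: 1 2 3)
qed

text \<open>The hypothesis \<open>refl\<close> forces the three entries of \<open>B\<close> away
  from index \<open>i\<close> to be coprime together with \<open>l\<close>. The resulting Bezout
  coefficients then combine Pfaffian kernel vectors into one with entry \<open>1\<close> at
  \<open>i\<close>.\<close>

lemma kernel_4:
  assumes N: "{1..n} = {i, j, k, m}" and dist: "distinct [i, j, k, m]"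
    and pf: "int l dvd B i j * B k m - B i k * B j m + B i m * B j k"
    and refl: "\<not> (\<exists>j\<in>{1..n}. \<exists>c::int. \<exists>!i. i \<in> {1..n} \<and> \<not> int l dvd c * B i j)"
  shows "\<exists>t. t i = 1 \<and> (\<forall>s\<in>{1..n}. int l dvd (\<Sum>j\<in>{1..n}. B s j * t j))"
proof -
  have mem: "i \<in> {1..n}" "j \<in> {1..n}" "k \<in> {1..n}" "m \<in> {1..n}" unfolding N by auto
  note [simp] = B_diag[OF mem(1)] B_diag[OF mem(2)] B_diag[OF mem(3)] B_diag[OF mem(4)]
    B_skew[OF mem(1,2)] B_skew[OF mem(1,3)] B_skew[OF mem(1,4)]
    B_skew[OF mem(2,3)] B_skew[OF mem(2,4)] B_skew[OF mem(3,4)]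
  have sum: "(\<Sum>j\<in>{1..n}. B s j * t j) = B s i * t i + B s j * t j + B s k * t k + B s m * t m"
    for s and t :: "nat \<Rightarrow> int"
    unfolding N using dist by simp
  define d where "d = gcd (B k m) (gcd (B j m) (gcd (B j k) (int l)))"
  have d: "d dvd B k m" "d dvd B j m" "d dvd B j k" "d dvd int l"
    unfolding d_def by (meson dvd_trans gcd_dvd1 gcd_dvd2)+
  then obtain c where c: "int l = d * c" by auto
  then have c0: "c \<noteq> 0" using l_gt_1 by auto
  have c_iff: "int l dvd c * b \<longleftrightarrow> d dvd b" for b
    using c0 by (simp add: c mult.commute[of d])
  \<comment> \<open>With \<open>c = l / d\<close>, a column \<open>s\<close> whose entries outside
    row \<open>i\<close> are divisible by \<open>d\<close> is killed by \<open>c\<close> outside row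
    \<open>i\<close>; by \<open>refl\<close> it is then killed in row \<open>i\<close> as
    well.\<close>
  have column: "d dvd B i s" if s: "s \<in> {1..n}" and "\<And>r. r \<in> {1..n} \<Longrightarrow> r \<noteq> i \<Longrightarrow> d dvd B r s" for s
  proof (rule ccontr)
    assume "\<not> d dvd B i s"
    then have "\<exists>!r. r \<in> {1..n} \<and> \<not> int l dvd c * B r s"
      unfolding c_iff using that(2) mem(1) by (intro ex1I[of _ i]) auto
    then show False using refl s by blast
  qed
  have "d dvd B i j" "d dvd B i k" "d dvd B i m"
    using d by (auto intro!: column simp only: N insert_iff empty_iff, auto)
  with d have "\<bar>d\<bar> = 1"
    by (intro no_common_divisor) (unfold N, auto)
  then have "d = 1" by (simp add: d_def)
  then obtain x y z w where bez: "x * B k m + y * B j m + z * B j k + w * int l = 1"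
    using bezout_int_4[of "B k m" "B j m" "B j k" "int l"] unfolding d_def by metis
  text \<open>A combination of the kernel vectors of the \<open>3 \<times> 3\<close> principal submatrices containing \<open>i\<close>;
    the remaining entry of their image under \<open>B\<close> is the Pfaffian up to sign.\<close>
  define t where "t = (\<lambda>_. 0)(i := 1, j := - y * B i m - z * B i k,
    k := - x * B i m + z * B i j, m := x * B i k + y * B i j)"
  have t: "t i = 1" "t j = - y * B i m - z * B i k" "t k = - x * B i m + z * B i j"
    "t m = x * B i k + y * B i j"
    using dist by (auto simp: t_def)
  let ?P = "B i j * B k m - B i k * B j m + B i m * B j k"
  \<comment> \<open>Multiplying the Bezout identity by \<open>b\<close> expands the contribution of
    \<open>t i = 1\<close> to each row and completes the other terms to a multiple of the
    Pfaffian.\<close>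
  have split: "b = b * (x * B k m + y * B j m + z * B j k) + int l * (b * w)" for b
    using arg_cong[OF bez, of "\<lambda>q. b * q"] by (simp add: algebra_simps)
  have "B i i * t i + B i j * t j + B i k * t k + B i m * t m = 0"
    by (simp add: t algebra_simps)
  moreover have "B j i * t i + B j j * t j + B j k * t k + B j m * t m = ?P * (- x) + int l * (- B i j * w)"
    using split[of "B i j"] by (simp add: t algebra_simps)
  moreover have "B k i * t i + B k j * t j + B k k * t k + B k m * t m = ?P * y + int l * (- B i k * w)"
    using split[of "B i k"] by (simp add: t algebra_simps)
  moreover have "B m i * t i + B m j * t j + B m k * t k + B m m * t m = ?P * (- z) + int l * (- B i m * w)"
    using split[of "B i m"] by (simp add: t algebra_simps)
  moreover have "int l dvd ?P * q + int l * q'" for q q'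
    by (rule dvd_add[OF dvd_mult2[OF pf] dvd_triv_left])
  ultimately have "int l dvd (\<Sum>j\<in>{1..n}. B s j * t j)" if "s \<in> {1..n}" for s
    using that unfolding sum by (auto simp only: N insert_iff empty_iff dvd_0_right)
  then show ?thesis using t(1) by blast
qed

text \<open>\<open>?reflection\<close> says that some power of some conjugation
  \<open>\<phi>_j\<close> moves exactly one generator.\<close>

lemma auslander_4_iff:
  assumes n: "n = 4"
  shows "satisfies_auslander S G \<longleftrightarrow> int l dvd pfaffian4 B \<and>
    \<not> (\<exists>j\<in>{1..n}. \<exists>c::int. \<exists>!i. i \<in> {1..n} \<and> \<not> int l dvd c * B i j)"
    (is "_ \<longleftrightarrow> _ \<and> \<not> ?reflection")
proof
  have N: "{1..n} = {1, 2, 3, 4}" using n by auto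
  have diag: "B 1 1 = 0" "B 2 2 = 0" "B 3 3 = 0" "B 4 4 = 0"
    by (rule B_diag; simp add: n)+
  have skew: "B 2 1 = - B 1 2" "B 3 1 = - B 1 3" "B 4 1 = - B 1 4" "B 3 2 = - B 2 3"
    "B 4 2 = - B 2 4" "B 4 3 = - B 3 4"
    by (rule B_skew; simp add: n)+
  {
    assume "satisfies_auslander S G"
    then have kernel: "\<exists>t. t i = 1 \<and> (\<forall>s\<in>{1..n}. int l dvd (\<Sum>j\<in>{1..n}. B s j * t j))" if "i \<in> {1..n}" for i
      using that by (simp only: auslander_iff)
    have "1 \<in> {1..n}" using n by simp
    from kernel[OF this] obtain t where t: "t 1 = 1" "\<And>s. s \<in> {1..n} \<Longrightarrow> int l dvd (\<Sum>j\<in>{1..n}. B s j * t j)"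
      by blast
    define r where "r s = B s 1 * t 1 + B s 2 * t 2 + B s 3 * t 3 + B s 4 * t 4" for s
    have "int l dvd r s" if "s \<in> {1..n}" for s
      using t(2)[OF that] unfolding N by (simp add: r_def add.assoc)
    moreover have "2 \<in> {1..n}" "3 \<in> {1..n}" "4 \<in> {1..n}" using n by auto
    \<comment> \<open>The weights come from the Pfaffian adjoint: they eliminate \<open>t 2\<close>,
      \<open>t 3\<close> and \<open>t 4\<close>, leaving a multiple of
      \<open>t 1 = 1\<close>.\<close>
    ultimately have "int l dvd - (B 3 4 * r 2 - B 2 4 * r 3 + B 2 3 * r 4)"
      by auto
    also have "- (B 3 4 * r 2 - B 2 4 * r 3 + B 2 3 * r 4) = pfaffian4 B"
      unfolding r_def pfaffian4_def t(1) diag skew by (simp add: algebra_simps)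
    finally have "int l dvd pfaffian4 B" .
    moreover have "\<not> ?reflection"
    proof
      assume ?reflection
      then obtain j c i where j: "j \<in> {1..n}" and i: "i \<in> {1..n}" "\<not> int l dvd c * B i j"
        and others: "\<And>s. s \<in> {1..n} \<Longrightarrow> s \<noteq> i \<Longrightarrow> int l dvd c * B s j"
        by (elim bexE exE ex1E) blast
      obtain t where t: "t i = 1" "int l dvd (\<Sum>s\<in>{1..n}. B j s * t s)"
        using kernel[OF i(1)] j by blast
      \<comment> \<open>After scaling row \<open>j\<close> by \<open>c\<close>, all terms except
        that at \<open>i\<close> vanish modulo \<open>l\<close>, and \<open>t i = 1\<close> leaves
        \<open>c * B i j\<close> up to sign.\<close>
      have "int l dvd c * (\<Sum>s\<in>{1..n}. B j s * t s)" using t(2) by simp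
      also have "c * (\<Sum>s\<in>{1..n}. B j s * t s) = (\<Sum>s\<in>{1..n}. - (c * B s j) * t s)"
        using j by (simp add: sum_distrib_left B_skew[of _ j] mult.assoc)
      also have "\<dots> = - (c * B i j) + (\<Sum>s\<in>{1..n} - {i}. - (c * B s j) * t s)"
        using i(1) t(1) by (subst sum.remove[of _ i]) auto
      finally have "int l dvd - (c * B i j) + (\<Sum>s\<in>{1..n} - {i}. - (c * B s j) * t s)" .
      moreover have "int l dvd (\<Sum>s\<in>{1..n} - {i}. - (c * B s j) * t s)"
        using others by (intro dvd_sum dvd_mult2) auto
      ultimately have "int l dvd - (c * B i j)" by (simp only: dvd_add_left_iff)
      then show False using i(2) by simp
    qed
    ultimately show "int l dvd pfaffian4 B \<and> \<not> ?reflection" ..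
  }
  assume asm: "int l dvd pfaffian4 B \<and> \<not> ?reflection"
  \<comment> \<open>Each index is brought to the front in turn; the Pfaffian changes by the sign of
    the permutation.\<close>
  have N': "{1..n} = {2, 1, 3, 4}" "{1..n} = {3, 1, 2, 4}" "{1..n} = {4, 1, 2, 3}"
    using N by auto
  have pf: "pfaffian4 B = B 1 2 * B 3 4 - B 1 3 * B 2 4 + B 1 4 * B 2 3"
    "- pfaffian4 B = B 2 1 * B 3 4 - B 2 3 * B 1 4 + B 2 4 * B 1 3"
    "pfaffian4 B = B 3 1 * B 2 4 - B 3 2 * B 1 4 + B 3 4 * B 1 2"
    "- pfaffian4 B = B 4 1 * B 2 3 - B 4 2 * B 1 3 + B 4 3 * B 1 2"
    unfolding pfaffian4_def skew by simp_all
  have dvd: "int l dvd pfaffian4 B" "int l dvd - pfaffian4 B" using asm by auto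
  show "satisfies_auslander S G"
    unfolding auslander_iff
    using kernel_4[OF N _ dvd(1)[unfolded pf(1)]] kernel_4[OF N'(1) _ dvd(2)[unfolded pf(2)]]
      kernel_4[OF N'(2) _ dvd(1)[unfolded pf(3)]] kernel_4[OF N'(3) _ dvd(2)[unfolded pf(4)]] asm
    by (subst N) simp
qed

end

theorem theorem0p5:
  fixes n :: nat and p :: "nat \<Rightarrow> nat \<Rightarrow> 'k::field_char_0"
    and \<xi> :: 'k and l :: nat and B :: "nat \<Rightarrow> nat \<Rightarrow> int"
  assumes "skew_poly_setting n p \<xi> l B"
  shows "(n = 2 \<longrightarrow> \<not> satisfies_auslander (skew_poly_ring n p) (conj_group n p)) \<and>
    (n = 3 \<longrightarrow>
      (satisfies_auslander (skew_poly_ring n p) (conj_group n p) \<longleftrightarrow>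
        (\<forall>i\<in>{1..3}. \<forall>j\<in>{1..3}. i \<noteq> j \<longrightarrow> gcd (B i j) (int l) = 1))) \<and>
    (n = 4 \<longrightarrow>
      (satisfies_auslander (skew_poly_ring n p) (conj_group n p) \<longleftrightarrow>
        [pfaffian4 B = 0] (mod int l) \<and>
        \<not> (\<exists>j\<in>{1..4}. \<exists>c::int. \<exists>!i. i \<in> {1..4} \<and> \<not> [c * B i j = 0] (mod int l))))"
  using skew_poly_setting.not_auslander_2[OF assms] skew_poly_setting.auslander_3_iff[OF assms]
    skew_poly_setting.auslander_4_iff[OF assms]
  by (auto simp: cong_0_iff)

end
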